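(* Let $0<\beta_0<\beta_c$, $b\in\{1,-1\}$, let $p\ge2$ be an integer and let $\ell\in\mathbb R$, $\ell\neq K^{(p)}(\beta_0)$, and assume that $(K^{(p)}(\beta_0)-\ell)b^p<0$. For $\alpha>0$ define $$\beta_n=\beta_0+\frac{b}{n^\alpha},\qquad K_n=K(\beta_0)+\sum_{j=1}^{p-1}\frac{K^{(j)}(\beta_0)b^j}{j!\,n^{j\alpha}}+\frac{\ell b^p}{p!\,n^{p\alpha}} .$$ Let $$g(x)=\frac1{p!}\beta_0\bigl(K^{(p)}(\beta_0)-\ell\bigr)b^px^2+c_4(\beta_0)x^4,\qquad \tilde g(x)=c_4(\beta_0)x^4,\qquad c_4(\beta_0)=\frac{(e^{\beta_0}+2)^2(4-e^{\beta_0})}{8\cdot4!},$$ let $\bar x>0$ be the unique positive global minimum point of $g$, and let $$\bar y=\frac{\int_{\mathbb R}|x|\exp[-\tilde g(x)]\,dx}{\int_{\mathbb R}\exp[-\tilde g(x)]\,dx},\qquad \bar z=\frac{\int_{\mathbb R}|x|\exp[-g(x)]\,dx}{\int_{\mathbb R}\exp[-g(x)]\,dx}.$$ Then: (a) For all $\alpha>0$, $m(\beta_n,K_n)\sim\bar x/n^{p\alpha/2}=\bar x|\beta_0-\beta_n|^{p/2}$. (b) For all $0<\alpha<\alpha_0=1/(2p)$, $E_{n,\beta_n,K_n}\{|S_n/n|\}\sim\bar x/n^{p\alpha/2}\sim m(\beta_n,K_n)$. (c) For all $\alpha>\alpha_0=1/(2p)$, $E_{n,\beta_n,K_n}\{|S_n/n|\}\sim\bar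 y/n^{1/4}\gg m(\beta_n,K_n)$. (d) For $\alpha=\alpha_0=1/(2p)$, $E_{n,\beta_n,K_n}\{|S_n/n|\}\sim\bar z/n^{1/4}\sim\bar z\cdot m(\beta_n,K_n)/\bar x$.
   Context: Mean-field Blume--Capel model. Let $\Lambda=\{1,0,-1\}$. For $n\in\mathbb N$, $K>0$ and $\omega=(\omega_1,\dots,\omega_n)\in\Lambda^n$ put $S_n(\omega)=\sum_{j=1}^n\omega_j$ and $H_{n,K}(\omega)=\sum_{j=1}^n\omega_j^2-\frac Kn\bigl(\sum_{j=1}^n\omega_j\bigr)^2$. For $\beta>0$, $P_{n,\beta,K}$ is the probability measure on $\Lambda^n$ giving $\omega$ probability proportional to $\exp[-\beta H_{n,K}(\omega)]$; $E_{n,\beta,K}$ denotes expectation with respect to $P_{n,\beta,K}$. Free-energy functional: $c_\beta(t)=\log\frac{1+e^{-\beta}(e^t+e^{-t})}{1+2e^{-\beta}}$ and $G_{\beta,K}(x)=\beta Kx^2-c_\beta(2\beta Kx)$ for $x\in\mathbb R$. $\mathcal M_{\beta,K}$ is the set of global minimum points of $G_{\beta,K}$. Let $\beta_c=\log4$ and $K(\beta)=(e^\beta+2)/(4\beta)$ for $\beta>0$; $K^{(j)}$ is the $j$th derivative of this function. The phase-coexistence region is the set of $(\beta,K)$, $\beta,K>0$, for which $\mathcal M_{\beta,K}$ has more than one element. It is known that for such $(\beta,K)$, $\mathcal M_{\beta,K}$ is $\{\pm m(\beta,K)\}$ or $\{0,\pm m(\beta,K)\}$ with $m(\beta,K)>0$;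 this unique positive global minimum point $m(\beta,K)$ is the thermodynamic magnetization. Notation: $a_n\sim b_n$ means $a_n/b_n\to1$ and $a_n\gg b_n$ means $a_n/b_n\to\infty$ as $n\to\infty$. All quantities are considered for $n$ large enough that $\beta_n,K_n>0$ and $(\beta_n,K_n)$ lies in the phase-coexistence region (which holds for all sufficiently large $n$ under the stated assumptions). *)

theory Defs
  imports "HOL-Probability.Probability" "HOL-Library.Landau_Symbols"
begin

definition configs :: "nat \<Rightarrow> (nat \<Rightarrow> real) set" where
  "configs n = {1..n} \<rightarrow>\<^sub>E {1, 0, -1}"

definition total_spin :: "nat \<Rightarrow> (nat \<Rightarrow> real) \<Rightarrow> real" where
  "total_spin n \<omega> = (\<Sum>j=1..n. \<omega> j)"

definition hamiltonian :: "nat \<Rightarrow> real \<Rightarrow> (nat \<Rightarrow> real) \<Rightarrow> real" where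
  "hamiltonian n K \<omega> = (\<Sum>j=1..n. (\<omega> j)\<^sup>2) - K / real n * (\<Sum>j=1..n. \<omega> j)\<^sup>2"

definition partition_fun :: "nat \<Rightarrow> real \<Rightarrow> real \<Rightarrow> real" where
  "partition_fun n \<beta> K = (\<Sum>\<omega>\<in>configs n. exp (- \<beta> * hamiltonian n K \<omega>))"

definition blume_capel :: "nat \<Rightarrow> real \<Rightarrow> real \<Rightarrow> (nat \<Rightarrow> real) measure" where
  "blume_capel n \<beta> K = point_measure (configs n)
     (\<lambda>\<omega>. ennreal (exp (- \<beta> * hamiltonian n K \<omega>) / partition_fun n \<beta> K))"

lemma finite_configs: "finite (configs n)"
  unfolding configs_def by (intro finite_PiE) auto

lemma partition_fun_pos: "partition_fun n \<beta> K > 0"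
proof -
  have "configs n \<noteq> {}"
    unfolding configs_def by (simp add: PiE_eq_empty_iff)
  then show ?thesis
    unfolding partition_fun_def by (intro sum_pos finite_configs) auto
qed

lemma prob_space_blume_capel: "prob_space (blume_capel n \<beta> K)"
  unfolding blume_capel_def
proof (rule prob_space_point_measure[OF finite_configs])
  show "0 \<le> ennreal (exp (- \<beta> * hamiltonian n K \<omega>) / partition_fun n \<beta> K)" for \<omega>
    by simp
  show "(\<Sum>\<omega>\<in>configs n. ennreal (exp (- \<beta> * hamiltonian n K \<omega>) / partition_fun n \<beta> K)) = 1"
    using partition_fun_pos[of n \<beta> K]
    by (subst sum_ennreal)
       (auto simp: partition_fun_def simp flip: sum_divide_distrib intro: less_imp_le)
qed

definition expected_abs_spin :: "nat \<Rightarrow> real \<Rightarrow> real \<Rightarrow> real" where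
  "expected_abs_spin n \<beta> K = (\<integral>\<omega>. \<bar>total_spin n \<omega> / real n\<bar> \<partial>blume_capel n \<beta> K)"

definition global_min_points :: "(real \<Rightarrow> real) \<Rightarrow> real set" where
  "global_min_points f = {x. \<forall>y. f x \<le> f y}"

text \<open>Meaningful only if \<open>f\<close> has exactly one positive global minimum point.\<close>

definition pos_min_point :: "(real \<Rightarrow> real) \<Rightarrow> real" where
  "pos_min_point f = (THE x. x > 0 \<and> x \<in> global_min_points f)"

definition c_fun :: "real \<Rightarrow> real \<Rightarrow> real" where
  "c_fun \<beta> t = ln ((1 + exp (- \<beta>) * (exp t + exp (- t))) / (1 + 2 * exp (- \<beta>)))"

definition G_fun :: "real \<Rightarrow> real \<Rightarrow> real \<Rightarrow> real" where
  "G_fun \<beta> K x = \<beta> * K * x\<^sup>2 - c_fun \<beta> (2 * \<beta> * K * x)"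

definition coexistence_region :: "(real \<times> real) set" where
  "coexistence_region = {(\<beta>, K). \<beta> > 0 \<and> K > 0 \<and>
     (\<exists>x\<in>global_min_points (G_fun \<beta> K). \<exists>y\<in>global_min_points (G_fun \<beta> K). x \<noteq> y)}"

definition magnetization :: "real \<Rightarrow> real \<Rightarrow> real" where
  "magnetization \<beta> K = pos_min_point (G_fun \<beta> K)"

definition beta_crit :: real where
  "beta_crit = ln 4"

definition K_curve :: "real \<Rightarrow> real" where
  "K_curve \<beta> = (exp \<beta> + 2) / (4 * \<beta>)"

abbreviation K_deriv :: "nat \<Rightarrow> real \<Rightarrow> real" where
  "K_deriv j \<equiv> (deriv ^^ j) K_curve"

definition beta_seq :: "real \<Rightarrow> real \<Rightarrow> real \<Rightarrow> nat \<Rightarrow> real" where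
  "beta_seq \<beta>\<^sub>0 b \<alpha> n = \<beta>\<^sub>0 + b / real n powr \<alpha>"

definition K_seq :: "real \<Rightarrow> real \<Rightarrow> nat \<Rightarrow> real \<Rightarrow> real \<Rightarrow> nat \<Rightarrow> real" where
  "K_seq \<beta>\<^sub>0 b p l \<alpha> n = K_curve \<beta>\<^sub>0
     + (\<Sum>j=1..p-1. K_deriv j \<beta>\<^sub>0 * b ^ j / (fact j * real n powr (real j * \<alpha>)))
     + l * b ^ p / (fact p * real n powr (real p * \<alpha>))"

definition c4 :: "real \<Rightarrow> real" where
  "c4 \<beta> = (exp \<beta> + 2)\<^sup>2 * (4 - exp \<beta>) / (8 * fact 4)"

definition g_poly :: "real \<Rightarrow> real \<Rightarrow> nat \<Rightarrow> real \<Rightarrow> real \<Rightarrow> real" where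
  "g_poly \<beta>\<^sub>0 b p l x =
     1 / fact p * \<beta>\<^sub>0 * (K_deriv p \<beta>\<^sub>0 - l) * b ^ p * x\<^sup>2 + c4 \<beta>\<^sub>0 * x ^ 4"

definition g_tilde :: "real \<Rightarrow> real \<Rightarrow> real" where
  "g_tilde \<beta>\<^sub>0 x = c4 \<beta>\<^sub>0 * x ^ 4"

definition gibbs_abs_mean :: "(real \<Rightarrow> real) \<Rightarrow> real" where
  "gibbs_abs_mean f =
     (\<integral>x. \<bar>x\<bar> * exp (- f x) \<partial>lborel) / (\<integral>x. exp (- f x) \<partial>lborel)"

end

theory Submission
  imports Defs "HOL-Real_Asymp.Real_Asymp"
begin

text \<open>The whole argument rests on one structural fact: for \<open>\<beta> < log 4\<close> the free-energy functional
\<open>G\<close> is an even function of \<open>x\<close> which is strictly convex in the variable \<open>s = x\<^sup>2\<close>. Equivalently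
\<open>c_fun \<beta>\<close> has \<open>c'(t) / t\<close> decreasing on \<open>t > 0\<close>, which is a hyperbolic inequality that holds as soon as
\<open>exp \<beta> \<le> 4\<close> (\<open>hyperbolic_concavity_bound\<close>, \<open>G_fun_strictly_convex_in_square\<close>).

Near \<open>x = 0\<close> one has \<open>G(x) = A\<^sub>n x\<^sup>2 + c\<^sub>4 x\<^sup>4 + o(x\<^sup>4)\<close> uniformly along the parameter sequence, and
\<open>A\<^sub>n = \<beta> K (K(\<beta>) - K) / K(\<beta>)\<close>. Taylor's formula for \<open>K(\<beta>)\<close> at \<open>\<beta>\<^sub>0\<close> shows that the sequence is tuned so that
\<open>n\<^bsup>p\<alpha>\<^esup> A\<^sub>n\<close> converges to the quadratic coefficient of \<open>g\<close>. With \<open>x = y / n\<^sup>\<gamma>\<close> the function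
\<open>n\<^bsup>4\<gamma>\<^esup> G(y / n\<^sup>\<gamma>)\<close> therefore converges pointwise: to \<open>g(y)\<close> if \<open>\<gamma> = p\<alpha>/2\<close>, and to \<open>g\<close> or to its
quartic part if \<open>\<gamma> = 1/4\<close> and \<open>\<alpha>\<close> is equal to or larger than \<open>1/(2p)\<close>.

Convexity in \<open>s = y\<^sup>2\<close> upgrades this pointwise convergence at no further cost. A convex function that lies
above its value at \<open>s\<^sub>0\<close> at two points \<open>s\<^sub>0 \<plusminus> d\<close> stays above it, with linear growth, outside the interval
between them. Consequently the minimizers converge (\<open>convergent_convex_minimizer\<close>), which
gives the asymptotics of the magnetization; for
\<open>\<alpha> \<ge> 1/(2p)\<close> the rescaled densities \<open>exp(- n G)\<close> are dominated by one Gaussian (\<open>gibbs_abs_mean_tendsto\<close>); and for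
\<open>\<alpha> < 1/(2p)\<close>, where the exponent carries the diverging factor \<open>n\<^bsup>1-4\<gamma>\<^esup>\<close>, the density concentrates at
the minimizer (\<open>gibbs_abs_mean_laplace\<close>).

The link with the spins is the Hubbard-Stratonovich transformation: \<open>S\<^sub>n/n\<close> plus an independent centred Gaussian
of standard deviation \<open>1 / sqrt (2 n \<beta> K)\<close> has density proportional to \<open>exp (- n G(x))\<close>. The Gaussian
changes \<open>E|S\<^sub>n/n|\<close> by \<open>O(n\<^bsup>-1/2\<^esup>)\<close> only (\<open>expected_abs_spin_close_to_gibbs_mean\<close>), which is negligible
because \<open>E|S\<^sub>n/n|\<close> has order \<open>n\<^bsup>-\<gamma>\<^esup>\<close> with \<open>\<gamma> \<le> 1/4\<close>.\<close>

section \<open>Strictly convex functions of the squared variable\<close>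

text \<open>The chord inequality is multiplied out, so that it survives pointwise manipulation without divisions; the left
end point \<open>x = 0\<close> is included, since \<open>s = x\<^sup>2\<close> ranges over the closed half-line.\<close>

definition strictly_convex_nonneg :: "(real \<Rightarrow> real) \<Rightarrow> bool" where
  "strictly_convex_nonneg \<phi> \<longleftrightarrow>
     (\<forall>x y z. 0 \<le> x \<and> x < y \<and> y < z \<longrightarrow> (z - x) * \<phi> y < (z - y) * \<phi> x + (y - x) * \<phi> z)"

lemma strictly_convex_nonnegD:
  assumes "strictly_convex_nonneg \<phi>" "0 \<le> x" "x < y" "y < z"
  shows "(z - x) * \<phi> y < (z - y) * \<phi> x + (y - x) * \<phi> z"
  using assms unfolding strictly_convex_nonneg_def by blast

lemma strictly_convex_nonneg_rescale:
  assumes "strictly_convex_nonneg \<phi>" and "a > 0" and "r > 0"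
  shows "strictly_convex_nonneg (\<lambda>s. a * \<phi> (r * s))"
  unfolding strictly_convex_nonneg_def
proof (intro allI impI, elim conjE)
  fix x y z :: real assume "0 \<le> x" "x < y" "y < z"
  then have "(r * z - r * x) * \<phi> (r * y) < (r * z - r * y) * \<phi> (r * x) + (r * y - r * x) * \<phi> (r * z)"
    using assms by (intro strictly_convex_nonnegD) auto
  then have "r * ((z - x) * \<phi> (r * y)) < r * ((z - y) * \<phi> (r * x) + (y - x) * \<phi> (r * z))"
    by (simp add: algebra_simps)
  then have "(z - x) * \<phi> (r * y) < (z - y) * \<phi> (r * x) + (y - x) * \<phi> (r * z)"
    using \<open>r > 0\<close> by (simp only: mult_less_cancel_left_pos)
  then have "a * ((z - x) * \<phi> (r * y)) < a * ((z - y) * \<phi> (r * x) + (y - x) * \<phi> (r * z))"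
    using \<open>a > 0\<close> by (simp only: mult_less_cancel_left_pos)
  then show "(z - x) * (a * \<phi> (r * y)) < (z - y) * (a * \<phi> (r * x)) + (y - x) * (a * \<phi> (r * z))"
    by (simp add: algebra_simps)
qed

text \<open>By Cauchy's mean value theorem the slope of \<open>s \<mapsto> F (sqrt s)\<close> over an interval is the value of
\<open>F' x / (2 x)\<close> at an intermediate point, and slopes of consecutive intervals are compared. Working with
\<open>F\<close> and the square function side by side avoids the derivative of \<open>sqrt\<close>, which does not exist at \<open>0\<close>.\<close>

lemma strictly_convex_nonneg_sqrt:
  fixes F :: "real \<Rightarrow> real"
  assumes deriv: "\<And>x. (F has_real_derivative F' x) (at x)"
    and mono: "\<And>x y. 0 < x \<Longrightarrow> x < y \<Longrightarrow> F' x / x < F' y / y"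
  shows "strictly_convex_nonneg (\<lambda>s. F (sqrt s))"
  unfolding strictly_convex_nonneg_def
proof (intro allI impI, elim conjE)
  fix x y z :: real assume xyz: "0 \<le> x" "x < y" "y < z"
  have chord: "\<exists>c. sqrt s < c \<and> c < sqrt t \<and> F (sqrt t) - F (sqrt s) = (t - s) * (F' c / (2 * c))"
    if st: "0 \<le> s" "s < t" for s t
  proof -
    have "\<exists>c. sqrt s < c \<and> c < sqrt t \<and>
        (F (sqrt t) - F (sqrt s)) * (2 * c) = ((sqrt t)\<^sup>2 - (sqrt s)\<^sup>2) * F' c"
      by (rule GMVT') (use st in \<open>auto intro!: deriv DERIV_isCont[OF deriv] derivative_eq_intros\<close>)
    then obtain c where c: "sqrt s < c" "c < sqrt t"
        "(F (sqrt t) - F (sqrt s)) * (2 * c) = ((sqrt t)\<^sup>2 - (sqrt s)\<^sup>2) * F' c" by blast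
    from c(1) st have "0 < c" by (meson order_le_less_trans real_sqrt_ge_zero)
    with c st show ?thesis by (intro exI[of _ c]) (auto simp: field_simps)
  qed
  obtain c where c: "sqrt x < c" "c < sqrt y" "F (sqrt y) - F (sqrt x) = (y - x) * (F' c / (2 * c))"
    using chord[of x y] xyz by auto
  obtain d where d: "sqrt y < d" "d < sqrt z" "F (sqrt z) - F (sqrt y) = (z - y) * (F' d / (2 * d))"
    using chord[of y z] xyz by auto
  have "0 < c" using c(1) xyz(1) by (meson order_le_less_trans real_sqrt_ge_zero)
  then have "F' c / c < F' d / d" using mono[of c d] c d by simp
  then have "F' c / (2 * c) < F' d / (2 * d)" by (simp add: field_simps)
  then have "(z - y) * (y - x) * (F' c / (2 * c)) < (z - y) * (y - x) * (F' d / (2 * d))"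
    using xyz by (intro mult_strict_left_mono) auto
  then have "(z - y) * (F (sqrt y) - F (sqrt x)) < (y - x) * (F (sqrt z) - F (sqrt y))"
    unfolding c(3) d(3) by (simp add: mult_ac)
  then show "(z - x) * F (sqrt y) < (z - y) * F (sqrt x) + (y - x) * F (sqrt z)"
    by (simp add: algebra_simps)
qed

text \<open>A margin \<open>h\<close> at distance \<open>d\<close> on both sides of \<open>c\<close> propagates outwards linearly. This turns
convergence at finitely many points into control on the whole half-line.\<close>

lemma convex_above_outside:
  assumes "strictly_convex_nonneg \<phi>" "0 \<le> c - d" "d > 0" "h \<ge> 0"
    and "\<phi> (c - d) \<ge> \<phi> c + h" "\<phi> (c + d) \<ge> \<phi> c + h"
    and "s \<ge> 0" "\<bar>s - c\<bar> \<ge> d"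
  shows "\<phi> s \<ge> \<phi> c + h / d * \<bar>s - c\<bar>"
proof -
  consider "s = c - d" | "s = c + d" | "s < c - d" | "s > c + d" using assms by linarith
  then show ?thesis
  proof cases
    case 3
    have "(c - s) * (\<phi> c + h) \<le> (c - s) * \<phi> (c - d)" using assms 3 by (intro mult_left_mono) auto
    also have "\<dots> < (c - (c - d)) * \<phi> s + (c - d - s) * \<phi> c"
      using assms 3 by (intro strictly_convex_nonnegD) auto
    finally have "d * \<phi> c + h * \<bar>s - c\<bar> \<le> d * \<phi> s" using 3 assms by (simp add: algebra_simps)
    moreover have "d * (\<phi> c + h / d * \<bar>s - c\<bar>) = d * \<phi> c + h * \<bar>s - c\<bar>"
      using \<open>d > 0\<close> by (simp add: distrib_left)
    ultimately show ?thesis using \<open>d > 0\<close> by (metis mult_le_cancel_left_pos)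
  next
    case 4
    have "(s - c) * (\<phi> c + h) \<le> (s - c) * \<phi> (c + d)" using assms 4 by (intro mult_left_mono) auto
    also have "\<dots> < (s - (c + d)) * \<phi> c + (c + d - c) * \<phi> s"
      using assms 4 by (intro strictly_convex_nonnegD) auto
    finally have "d * \<phi> c + h * \<bar>s - c\<bar> \<le> d * \<phi> s" using 4 assms by (simp add: algebra_simps)
    moreover have "d * (\<phi> c + h / d * \<bar>s - c\<bar>) = d * \<phi> c + h * \<bar>s - c\<bar>"
      using \<open>d > 0\<close> by (simp add: distrib_left)
    ultimately show ?thesis using \<open>d > 0\<close> by (metis mult_le_cancel_left_pos)
  qed (use assms in auto)
qed

lemma convex_below_inside:
  assumes "strictly_convex_nonneg \<phi>" "0 \<le> x" "x \<le> s" "s \<le> y"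
  shows "\<phi> s \<le> max (\<phi> x) (\<phi> y)"
proof (cases "s = x \<or> s = y")
  case False
  then have *: "x < s" "s < y" using assms by auto
  have "(y - x) * \<phi> s < (y - s) * \<phi> x + (s - x) * \<phi> y"
    using assms * by (intro strictly_convex_nonnegD) auto
  also have "\<dots> \<le> (y - s) * max (\<phi> x) (\<phi> y) + (s - x) * max (\<phi> x) (\<phi> y)"
    using * by (intro add_mono mult_left_mono) auto
  also have "\<dots> = (y - x) * max (\<phi> x) (\<phi> y)" by (simp add: algebra_simps)
  finally have "\<phi> s < max (\<phi> x) (\<phi> y)" using * by (simp only: mult_less_cancel_left_pos)
  then show ?thesis by simp
qed auto

text \<open>Beyond \<open>\<sigma>\<close> the function lies above the ray from the origin through its value at \<open>\<sigma>\<close>; before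
\<open>\<sigma>\<close> it lies above the line through its values at \<open>\<sigma>\<close> and \<open>2 \<sigma>\<close>, which costs the
additive constant. Only two values of \<open>\<phi>\<close> enter, so the bound is uniform along convergent sequences.\<close>

lemma convex_linear_lower_bound:
  assumes conv: "strictly_convex_nonneg \<phi>" and "\<phi> 0 = 0" and "\<sigma> > 0" and "\<phi> \<sigma> \<ge> 0" and "s \<ge> 0"
  shows "\<phi> s \<ge> \<phi> \<sigma> / \<sigma> * s - \<bar>\<phi> (2 * \<sigma>) - \<phi> \<sigma>\<bar>"
proof -
  consider "s < \<sigma>" | "s = \<sigma>" | "s > \<sigma>" by linarith
  then show ?thesis
  proof cases
    case 1
    have "(2 * \<sigma> - s) * \<phi> \<sigma> < (2 * \<sigma> - \<sigma>) * \<phi> s + (\<sigma> - s) * \<phi> (2 * \<sigma>)"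
      using assms 1 by (intro strictly_convex_nonnegD) auto
    then have "\<sigma> * \<phi> s > \<sigma> * \<phi> \<sigma> - (\<sigma> - s) * (\<phi> (2 * \<sigma>) - \<phi> \<sigma>)" by (simp add: algebra_simps)
    moreover have "(\<sigma> - s) * (\<phi> (2 * \<sigma>) - \<phi> \<sigma>) \<le> \<sigma> * \<bar>\<phi> (2 * \<sigma>) - \<phi> \<sigma>\<bar>"
      using assms 1 by (intro order_trans[OF abs_ge_self[of "_ * _"]])
         (auto simp: abs_mult intro!: mult_right_mono)
    moreover have "s * \<phi> \<sigma> \<le> \<sigma> * \<phi> \<sigma>" using assms 1 by (intro mult_right_mono) auto
    ultimately have "\<sigma> * (\<phi> \<sigma> / \<sigma> * s - \<bar>\<phi> (2 * \<sigma>) - \<phi> \<sigma>\<bar>) \<le> \<sigma> * \<phi> s"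
      using \<open>\<sigma> > 0\<close> by (simp add: algebra_simps)
    then show ?thesis using \<open>\<sigma> > 0\<close> by simp
  next
    case 3
    have "(s - 0) * \<phi> \<sigma> < (s - \<sigma>) * \<phi> 0 + (\<sigma> - 0) * \<phi> s"
      using assms 3 by (intro strictly_convex_nonnegD) auto
    then have "\<phi> s > \<phi> \<sigma> / \<sigma> * s" using assms by (simp add: field_simps)
    then show ?thesis by linarith
  qed (use assms in auto)
qed

text \<open>Transfers minimization in \<open>s = x\<^sup>2\<close> back to \<open>x\<close>: two different minimizers in \<open>s\<close> would have a
midpoint with a smaller value.\<close>

lemma even_function_pos_min_point:
  assumes even: "\<And>x. F (- x) = F x"
    and conv: "strictly_convex_nonneg (\<lambda>s. F (sqrt s))"
    and "s > 0" and min: "\<And>t. t \<ge> 0 \<Longrightarrow> F (sqrt s) \<le> F (sqrt t)"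
  shows "x \<in> global_min_points F \<longleftrightarrow> x = sqrt s \<or> x = - sqrt s"
    and "\<exists>!x. x > 0 \<and> x \<in> global_min_points F"
    and "pos_min_point F = sqrt s"
proof -
  have abs: "F \<bar>x\<bar> = F x" for x by (cases "x \<ge> 0") (auto simp: even)
  have sq: "F (sqrt (x\<^sup>2)) = F x" for x by (simp add: abs)
  have low: "F (sqrt s) \<le> F x" for x using min[of "x\<^sup>2"] by (simp add: abs)
  have uniq: "F (sqrt s) < F (sqrt t)" if "t \<ge> 0" "t \<noteq> s" for t
  proof (rule ccontr)
    assume "\<not> ?thesis"
    then have eq: "F (sqrt t) = F (sqrt s)" using min[of t] that by simp
    define u where "u = (s + t) / 2"
    have "F (sqrt u) < F (sqrt s)"
    proof (cases "s < t")
      case True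
      have "(t - s) * F (sqrt u) < (t - u) * F (sqrt s) + (u - s) * F (sqrt t)"
        using True \<open>s > 0\<close> by (intro strictly_convex_nonnegD[OF conv]) (auto simp: u_def)
      also have "\<dots> = (t - s) * F (sqrt s)" unfolding eq by (simp add: algebra_simps)
      finally show ?thesis using True by (simp only: mult_less_cancel_left_pos)
    next
      case False
      have "(s - t) * F (sqrt u) < (s - u) * F (sqrt t) + (u - t) * F (sqrt s)"
        using False that by (intro strictly_convex_nonnegD[OF conv]) (auto simp: u_def)
      also have "\<dots> = (s - t) * F (sqrt s)" unfolding eq by (simp add: algebra_simps)
      finally show ?thesis using False that by (simp only: mult_less_cancel_left_pos)
    qed
    moreover have "u \<ge> 0" using that \<open>s > 0\<close> by (simp add: u_def)
    ultimately show False using min[of u] by simp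
  qed
  show iff: "x \<in> global_min_points F \<longleftrightarrow> x = sqrt s \<or> x = - sqrt s" for x
  proof
    assume "x \<in> global_min_points F"
    then have "F x \<le> F (sqrt s)" by (simp add: global_min_points_def)
    then have "x\<^sup>2 = s" using uniq[of "x\<^sup>2"] by (force simp: abs)
    then have "sqrt s = \<bar>x\<bar>" by (metis real_sqrt_abs)
    then show "x = sqrt s \<or> x = - sqrt s" by auto
  next
    assume "x = sqrt s \<or> x = - sqrt s"
    then show "x \<in> global_min_points F" using low even by (auto simp: global_min_points_def)
  qed
  have *: "x > 0 \<and> x \<in> global_min_points F \<longleftrightarrow> x = sqrt s" for x
    unfolding iff using \<open>s > 0\<close> by (auto dest: less_trans)
  show "\<exists>!x. x > 0 \<and> x \<in> global_min_points F" unfolding * by simp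
  show "pos_min_point F = sqrt s" unfolding pos_min_point_def * by simp
qed

text \<open>As soon as the values at \<open>s\<^sub>0 \<plusminus> d\<close> exceed the value at \<open>s\<^sub>0\<close>, a minimizer over the compact interval between
them is a global one, and it is the only one; now let \<open>d\<close> shrink.\<close>

lemma convergent_convex_minimizer:
  fixes \<Phi> :: "nat \<Rightarrow> real \<Rightarrow> real"
  assumes conv: "\<And>n. n \<ge> N \<Longrightarrow> strictly_convex_nonneg (\<Phi> n)"
    and cont: "\<And>n. n \<ge> N \<Longrightarrow> continuous_on {0..} (\<Phi> n)"
    and lim: "\<And>s. s \<ge> 0 \<Longrightarrow> (\<lambda>n. \<Phi> n s) \<longlonglongrightarrow> \<Psi> s"
    and "s\<^sub>0 > 0" and min: "\<And>s. s \<ge> 0 \<Longrightarrow> s \<noteq> s\<^sub>0 \<Longrightarrow> \<Psi> s\<^sub>0 < \<Psi> s"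
  obtains s where "s \<longlonglongrightarrow> s\<^sub>0" and "\<forall>\<^sub>F n in sequentially. s n > 0 \<and> (\<forall>t\<ge>0. \<Phi> n (s n) \<le> \<Phi> n t)"
proof -
  have near: "\<forall>\<^sub>F n in sequentially. \<exists>s. \<bar>s - s\<^sub>0\<bar> \<le> d \<and> s > 0 \<and> (\<forall>t\<ge>0. \<Phi> n s \<le> \<Phi> n t)"
    if d: "0 < d" "d < s\<^sub>0" for d
  proof -
    have "\<forall>\<^sub>F n in sequentially. 0 < \<Phi> n (s\<^sub>0 - d) - \<Phi> n s\<^sub>0"
      using d min[of "s\<^sub>0 - d"] by (intro order_tendstoD[OF tendsto_diff[OF lim lim]]) auto
    moreover have "\<forall>\<^sub>F n in sequentially. 0 < \<Phi> n (s\<^sub>0 + d) - \<Phi> n s\<^sub>0"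
      using d min[of "s\<^sub>0 + d"] by (intro order_tendstoD[OF tendsto_diff[OF lim lim]]) auto
    ultimately show ?thesis using eventually_ge_at_top[of N]
    proof eventually_elim
      case (elim n)
      have "continuous_on {s\<^sub>0 - d..s\<^sub>0 + d} (\<Phi> n)"
        using d elim by (intro continuous_on_subset[OF cont]) auto
      then obtain s where s: "s \<in> {s\<^sub>0 - d..s\<^sub>0 + d}" "\<forall>t\<in>{s\<^sub>0 - d..s\<^sub>0 + d}. \<Phi> n s \<le> \<Phi> n t"
        using continuous_attains_inf[of "{s\<^sub>0 - d..s\<^sub>0 + d}" "\<Phi> n"] d by auto
      have "\<Phi> n s \<le> \<Phi> n t" if "t \<ge> 0" for t
      proof (cases "\<bar>t - s\<^sub>0\<bar> \<le> d")
        case True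
        then have "t \<in> {s\<^sub>0 - d..s\<^sub>0 + d}" unfolding abs_le_iff by simp
        then show ?thesis using s(2) by blast
      next
        case False
        have "\<Phi> n s \<le> \<Phi> n s\<^sub>0" using s d by auto
        also have "\<dots> \<le> \<Phi> n t"
          using convex_above_outside[OF conv, of n s\<^sub>0 d 0 t] d elim that False by auto
        finally show ?thesis .
      qed
      then show ?case using s d by (intro exI[of _ s]) auto
    qed
  qed
  define P where "P n s \<longleftrightarrow> s > 0 \<and> (\<forall>t\<ge>0. \<Phi> n s \<le> \<Phi> n t)" for n s
  define s where "s n = (SOME s. P n s)" for n
  have ex: "\<forall>\<^sub>F n in sequentially. P n (s n)"
    using near[of "s\<^sub>0 / 2"]
  proof (rule eventually_mono)
    show "P n (s n)" if "\<exists>s. \<bar>s - s\<^sub>0\<bar> \<le> s\<^sub>0 / 2 \<and> s > 0 \<and> (\<forall>t\<ge>0. \<Phi> n s \<le> \<Phi> n t)" for n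
    proof -
      have "\<exists>s. P n s" using that by (auto simp: P_def)
      then show ?thesis unfolding s_def by (rule someI_ex)
    qed
  qed (use \<open>s\<^sub>0 > 0\<close> in auto)
  have uniq: "a = b" if "P n a" "P n b" "n \<ge> N" for n a b
  proof (rule ccontr)
    assume "a \<noteq> b"
    define x z where "x = min a b" and "z = max a b"
    have xz: "0 < x" "x < z" "P n x" "P n z" using \<open>a \<noteq> b\<close> that
      by (auto simp: x_def z_def P_def min_def max_def)
    have "(z - x) * \<Phi> n ((x + z) / 2) < (z - (x + z) / 2) * \<Phi> n x + ((x + z) / 2 - x) * \<Phi> n z"
      using xz that by (intro strictly_convex_nonnegD[OF conv]) auto
    also have "\<dots> \<le> (z - (x + z) / 2) * \<Phi> n ((x + z) / 2) + ((x + z) / 2 - x) * \<Phi> n ((x + z) / 2)"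
      using xz by (intro add_mono mult_left_mono) (auto simp: P_def)
    also have "\<dots> = (z - x) * \<Phi> n ((x + z) / 2)" by (simp add: field_simps)
    finally show False by simp
  qed
  have "s \<longlonglongrightarrow> s\<^sub>0"
  proof (rule tendstoI)
    fix e :: real assume "e > 0"
    define d where "d = min e s\<^sub>0 / 2"
    have d: "0 < d" "d < s\<^sub>0" "d < e" using \<open>e > 0\<close> \<open>s\<^sub>0 > 0\<close> by (auto simp: d_def min_def)
    show "\<forall>\<^sub>F n in sequentially. dist (s n) s\<^sub>0 < e"
      using near[OF d(1,2)] ex eventually_ge_at_top[of N]
    proof eventually_elim
      case (elim n)
      then obtain u where u: "\<bar>u - s\<^sub>0\<bar> \<le> d" "P n u" by (auto simp: P_def)
      then have "u = s n" using uniq elim by blast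
      then show ?case using u d by (simp add: dist_real_def)
    qed
  qed
  then show thesis using ex by (intro that) (auto simp: P_def)
qed

section \<open>The free-energy functional\<close>

lemma c_fun_deriv:
  "(c_fun \<beta> has_real_derivative
     (2 * sinh t / (exp \<beta> + 2 * cosh t))) (at t)"
proof -
  have pos: "1 + exp (- \<beta>) * (exp t + exp (- t)) > 0" "1 + 2 * exp (- \<beta>) > 0"
    by (auto intro!: add_pos_pos mult_pos_pos)
  have eq: "exp (- \<beta>) * (exp t - exp (- t)) / (1 + exp (- \<beta>) * (exp t + exp (- t)))
      = 2 * sinh t / (exp \<beta> + 2 * cosh t)"
  proof -
    have "2 * sinh t / (exp \<beta> + 2 * cosh t) = (exp (- \<beta>) * (2 * sinh t)) / (exp (- \<beta>) * (exp \<beta> + 2 * cosh t))"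
      by simp
    moreover have "exp (- \<beta>) * (exp \<beta> + 2 * cosh t) = 1 + exp (- \<beta>) * (exp t + exp (- t))"
      by (simp add: algebra_simps cosh_field_def exp_minus_inverse flip: exp_add)
    moreover have "2 * sinh t = exp t - exp (- t)" by (simp add: sinh_field_def)
    ultimately show ?thesis by simp
  qed
  show ?thesis
    unfolding c_fun_def[abs_def] using pos
    by (auto intro!: derivative_eq_intros simp flip: eq)
qed

lemma sinh_gt_self: "(x::real) > 0 \<Longrightarrow> sinh x > x"
proof -
  assume "x > 0"
  have "(\<lambda>x. sinh x - x) 0 < (\<lambda>x. sinh x - x) x"
    by (rule DERIV_pos_imp_increasing_open[OF \<open>x > 0\<close>])
       (auto intro!: exI derivative_eq_intros continuous_intros simp: cosh_real_nonneg_less_iff[of 0, simplified])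
  then show ?thesis by simp
qed

lemma sinh_lt_mult_cosh: "(x::real) > 0 \<Longrightarrow> sinh x < x * cosh x"
proof -
  assume "x > 0"
  have "(\<lambda>x. x * cosh x - sinh x) 0 < (\<lambda>x. x * cosh x - sinh x) x"
    by (rule DERIV_pos_imp_increasing_open[OF \<open>x > 0\<close>])
       (auto intro!: exI derivative_eq_intros continuous_intros)
  then show ?thesis by simp
qed

text \<open>Subtracting the two sides gives \<open>sinh x cosh x - x - r (x cosh x - sinh x)\<close>, which is worst for \<open>r = 2\<close>. For
\<open>r = 2\<close> its derivative is \<open>2 sinh x (sinh x - x) > 0\<close>. The value \<open>r = exp \<beta> / 2 = 2\<close> is the critical
inverse temperature \<open>\<beta> = log 4\<close>.\<close>

lemma hyperbolic_concavity_bound: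
  fixes r x :: real
  assumes "r \<le> 2" and "x > 0"
  shows "x * (r * cosh x + 1) < sinh x * (r + cosh x)"
proof -
  define f where "f = (\<lambda>x::real. sinh x * (2 + cosh x) - x * (2 * cosh x + 1))"
  have "f 0 < f x"
  proof (rule DERIV_pos_imp_increasing_open[OF \<open>x > 0\<close>])
    fix y :: real assume y: "0 < y" "y < x"
    have "(f has_real_derivative 2 * sinh y * (sinh y - y)) (at y)"
      unfolding f_def
      by (auto intro!: derivative_eq_intros simp: algebra_simps)
         (use cosh_square_eq[of y] in \<open>simp add: power2_eq_square\<close>)
    moreover have "2 * sinh y * (sinh y - y) > 0" using y sinh_gt_self[of y] by simp
    ultimately show "\<exists>D. (f has_real_derivative D) (at y) \<and> D > 0" by blast
  qed (auto simp: f_def intro!: continuous_intros)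
  then have "x * (2 * cosh x + 1) < sinh x * (2 + cosh x)" by (simp add: f_def)
  moreover have "(2 - r) * (x * cosh x - sinh x) \<ge> 0"
    using assms sinh_lt_mult_cosh[of x] by simp
  ultimately show ?thesis by (simp add: algebra_simps)
qed

text \<open>The numerator of the derivative of \<open>c'(t) / t\<close> is, up to the factor \<open>4\<close>, the difference of the two sides of
\<open>hyperbolic_concavity_bound\<close> with \<open>r = exp \<beta> / 2\<close>.\<close>

lemma c_fun_deriv_over_arg_decreasing:
  fixes \<beta> :: real
  assumes "exp \<beta> < 4" and "0 < s" and "s < t"
  shows "2 * sinh t / (exp \<beta> + 2 * cosh t) / t < 2 * sinh s / (exp \<beta> + 2 * cosh s) / s"
proof -
  have D: "exp \<beta> + 2 * cosh x > 0" for x :: real by (intro add_pos_pos) auto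
  have "\<exists>D. ((\<lambda>x. 2 * sinh x / ((exp \<beta> + 2 * cosh x) * x)) has_real_derivative D) (at x) \<and> D < 0"
    if x: "s \<le> x" "x \<le> t" for x
  proof -
    have "x > 0" using x assms by simp
    let ?d = "exp \<beta> + 2 * cosh x"
    have "((\<lambda>x. 2 * sinh x / ((exp \<beta> + 2 * cosh x) * x)) has_real_derivative
        (2 * cosh x * (?d * x) - 2 * sinh x * (2 * sinh x * x + ?d)) / ((?d * x) * (?d * x))) (at x)"
      using D[of x] \<open>x > 0\<close> by (auto intro!: derivative_eq_intros)
    moreover have "2 * cosh x * (?d * x) - 2 * sinh x * (2 * sinh x * x + ?d)
        = 4 * (x * (exp \<beta> / 2 * cosh x + 1) - sinh x * (exp \<beta> / 2 + cosh x))"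
    proof -
      have "cosh x * cosh x = sinh x * sinh x + 1"
        using cosh_square_eq[of x] by (simp add: power2_eq_square)
      then show ?thesis by algebra
    qed
    moreover have "4 * (x * (exp \<beta> / 2 * cosh x + 1) - sinh x * (exp \<beta> / 2 + cosh x)) / ((?d * x) * (?d * x)) < 0"
      using hyperbolic_concavity_bound[of "exp \<beta> / 2" x] assms(1) \<open>x > 0\<close> D[of x]
      by (intro divide_neg_pos) auto
    ultimately show ?thesis by auto
  qed
  from DERIV_neg_imp_decreasing[OF \<open>s < t\<close> this] show ?thesis by simp
qed

lemma G_fun_deriv:
  "(G_fun \<beta> K has_real_derivative
     2 * \<beta> * K * x - 2 * \<beta> * K * (2 * sinh (2 * \<beta> * K * x) / (exp \<beta> + 2 * cosh (2 * \<beta> * K * x)))) (at x)"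
  unfolding G_fun_def[abs_def]
  by (auto intro!: derivative_eq_intros DERIV_chain2[OF c_fun_deriv])

lemma G_fun_uminus: "G_fun \<beta> K (- x) = G_fun \<beta> K x"
  by (simp add: G_fun_def c_fun_def add.commute)

lemma G_fun_0: "G_fun \<beta> K 0 = 0"
proof -
  have "1 + 2 * exp (- \<beta>) > 0" by (intro add_pos_pos) auto
  then show ?thesis by (simp add: G_fun_def c_fun_def mult.commute)
qed

lemma continuous_on_G_fun: "continuous_on A (G_fun \<beta> K)"
  by (intro continuous_at_imp_continuous_on ballI DERIV_isCont[OF G_fun_deriv])

lemma G_fun_strictly_convex_in_square:
  assumes "exp \<beta> < 4" and "\<beta> > 0" and "K > 0"
  shows "strictly_convex_nonneg (\<lambda>s. G_fun \<beta> K (sqrt s))"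
proof (rule strictly_convex_nonneg_sqrt[OF G_fun_deriv])
  fix x y :: real assume xy: "0 < x" "x < y"
  define k where "k = 2 * \<beta> * K"
  have "k > 0" using assms by (simp add: k_def)
  define f where "f = (\<lambda>t. 2 * sinh t / (exp \<beta> + 2 * cosh t))"
  have "f (k * y) / (k * y) < f (k * x) / (k * x)" unfolding f_def
    using c_fun_deriv_over_arg_decreasing[OF assms(1), of "k * x" "k * y"] xy \<open>k > 0\<close> by simp
  then have "k * k * (f (k * y) / (k * y)) < k * k * (f (k * x) / (k * x))"
    using \<open>k > 0\<close> by (intro mult_strict_left_mono) auto
  then have "(k * x - k * f (k * x)) / x < (k * y - k * f (k * y)) / y"
    using \<open>k > 0\<close> xy by (simp add: diff_divide_distrib mult.assoc)
  then show "(2 * \<beta> * K * x - 2 * \<beta> * K * (2 * sinh (2 * \<beta> * K * x) / (exp \<beta> + 2 * cosh (2 * \<beta> * K * x)))) / x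
      < (2 * \<beta> * K * y - 2 * \<beta> * K * (2 * sinh (2 * \<beta> * K * y) / (exp \<beta> + 2 * cosh (2 * \<beta> * K * y)))) / y"
    by (simp add: f_def k_def)
qed

section \<open>Gaussian smoothing of the total spin\<close>

text \<open>\<open>exp (- G)\<close> is a quadratic weight times the moment generating function of a single spin under
the one-site measure \<open>exp (- \<beta> s\<^sup>2)\<close>; its \<open>n\<close>-th power factorizes over the sites.\<close>

lemma G_fun_single_spin:
  "exp (- G_fun \<beta> K x) = exp (- \<beta> * K * x\<^sup>2) * (\<Sum>s\<in>{1, 0, -1}. exp (- \<beta> * s\<^sup>2 + 2 * \<beta> * K * x * s)) / (1 + 2 * exp (- \<beta>))"
proof -
  have "1 + exp (- \<beta>) * (exp (2 * \<beta> * K * x) + exp (- (2 * \<beta> * K * x))) > 0" "1 + 2 * exp (- \<beta>) > 0"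
    by (auto intro!: add_pos_pos mult_pos_pos)
  then have "exp (c_fun \<beta> (2 * \<beta> * K * x))
      = (1 + exp (- \<beta>) * (exp (2 * \<beta> * K * x) + exp (- (2 * \<beta> * K * x)))) / (1 + 2 * exp (- \<beta>))"
    unfolding c_fun_def by (intro exp_ln divide_pos_pos)
  also have "1 + exp (- \<beta>) * (exp (2 * \<beta> * K * x) + exp (- (2 * \<beta> * K * x)))
      = (\<Sum>s\<in>{1, 0, -1}. exp (- \<beta> * s\<^sup>2 + 2 * \<beta> * K * x * s))"
    by (simp add: algebra_simps flip: exp_add)
  finally have "exp (c_fun \<beta> (2 * \<beta> * K * x))
      = (\<Sum>s\<in>{1, 0, -1}. exp (- \<beta> * s\<^sup>2 + 2 * \<beta> * K * x * s)) / (1 + 2 * exp (- \<beta>))" .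
  moreover have "exp (- G_fun \<beta> K x) = exp (- \<beta> * K * x\<^sup>2) * exp (c_fun \<beta> (2 * \<beta> * K * x))"
    unfolding G_fun_def by (simp flip: exp_add)
  ultimately show ?thesis by simp
qed

text \<open>Completing the square, the Gaussian density centred at \<open>S\<^sub>n / n\<close> absorbs the interaction term
\<open>exp (\<beta> K S\<^sub>n\<^sup>2 / n)\<close> and leaves a term linear in the spins, so that the sum over configurations becomes a product
of single-site sums.\<close>

lemma hubbard_stratonovich:
  assumes "n > 0" "\<beta> > 0" "K > 0" and \<sigma>: "\<sigma> = 1 / sqrt (2 * real n * \<beta> * K)"
  obtains C where "C > 0"
    and "\<And>x. (\<Sum>\<omega>\<in>configs n. exp (- \<beta> * hamiltonian n K \<omega>) * normal_density (total_spin n \<omega> / n) \<sigma> x)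
             = C * exp (- (real n * G_fun \<beta> K x))"
proof
  define c where "c = 1 / sqrt (2 * pi * \<sigma>\<^sup>2)"
  define f where "f x s = exp (- \<beta> * s\<^sup>2 + 2 * \<beta> * K * x * s)" for x s :: real
  have "\<sigma> > 0" using assms by simp
  have var: "2 * \<sigma>\<^sup>2 = 1 / (n * \<beta> * K)" using assms by (simp add: power_divide)
  show "c * (1 + 2 * exp (- \<beta>)) ^ n > 0"
    using \<open>\<sigma> > 0\<close> unfolding c_def by (intro mult_pos_pos zero_less_power add_pos_pos) auto
  show "(\<Sum>\<omega>\<in>configs n. exp (- \<beta> * hamiltonian n K \<omega>) * normal_density (total_spin n \<omega> / n) \<sigma> x)
             = c * (1 + 2 * exp (- \<beta>)) ^ n * exp (- (real n * G_fun \<beta> K x))" for x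
  proof -
    have weight: "exp (- \<beta> * hamiltonian n K \<omega>) * normal_density (total_spin n \<omega> / n) \<sigma> x
        = c * exp (- \<beta> * K * x\<^sup>2) ^ n * (\<Prod>j=1..n. f x (\<omega> j))" for \<omega>
    proof -
      define S where "S = total_spin n \<omega>"
      define Q where "Q = (\<Sum>j=1..n. (\<omega> j)\<^sup>2)"
      have "(\<Sum>j=1..n. - \<beta> * (\<omega> j)\<^sup>2 + 2 * \<beta> * K * x * \<omega> j) = - \<beta> * Q + 2 * \<beta> * K * x * S"
        unfolding S_def Q_def total_spin_def sum.distrib sum_distrib_left ..
      then have "(\<Prod>j=1..n. f x (\<omega> j)) = exp (- \<beta> * Q + 2 * \<beta> * K * x * S)"
        unfolding f_def by (simp flip: exp_sum)
      moreover have "exp (- \<beta> * hamiltonian n K \<omega>) * normal_density (total_spin n \<omega> / n) \<sigma> x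
          = c * exp (- \<beta> * (Q - K / n * S\<^sup>2) + (-(x - S / n)\<^sup>2 / (1 / (n * \<beta> * K))))"
        unfolding normal_density_def hamiltonian_def var c_def S_def Q_def total_spin_def exp_add
        by simp
      moreover have "- \<beta> * (Q - K / n * S\<^sup>2) + (-(x - S / n)\<^sup>2 / (1 / (n * \<beta> * K)))
          = real n * (- \<beta> * K * x\<^sup>2) + (- \<beta> * Q + 2 * \<beta> * K * x * S)"
        using \<open>n > 0\<close> by (simp add: power2_eq_square field_simps)
      moreover have "exp (real n * (- \<beta> * K * x\<^sup>2) + (- \<beta> * Q + 2 * \<beta> * K * x * S))
          = exp (- \<beta> * K * x\<^sup>2) ^ n * exp (- \<beta> * Q + 2 * \<beta> * K * x * S)"
        unfolding exp_add[of "real n * _"] exp_of_nat_mult ..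
      ultimately show ?thesis by simp
    qed
    have "(\<Sum>\<omega>\<in>configs n. exp (- \<beta> * hamiltonian n K \<omega>) * normal_density (total_spin n \<omega> / n) \<sigma> x)
        = c * exp (- \<beta> * K * x\<^sup>2) ^ n * (\<Sum>\<omega>\<in>configs n. \<Prod>j=1..n. f x (\<omega> j))"
      unfolding weight sum_distrib_left ..
    also have "(\<Sum>\<omega>\<in>configs n. \<Prod>j=1..n. f x (\<omega> j)) = (\<Sum>s\<in>{1, 0, -1}. f x s) ^ n"
      unfolding configs_def by (subst prod_sum_PiE[symmetric]) auto
    also have "c * exp (- \<beta> * K * x\<^sup>2) ^ n * (\<Sum>s\<in>{1, 0, -1}. f x s) ^ n
        = c * (1 + 2 * exp (- \<beta>)) ^ n *
          (exp (- \<beta> * K * x\<^sup>2) * (\<Sum>s\<in>{1, 0, -1}. f x s) / (1 + 2 * exp (- \<beta>))) ^ n"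
    proof -
      have "1 + 2 * exp (- \<beta>) > 0" by (intro add_pos_pos) auto
      then show ?thesis by (simp add: power_divide power_mult_distrib del: sum.insert)
    qed
    also have "\<dots> = c * (1 + 2 * exp (- \<beta>)) ^ n * exp (- (real n * G_fun \<beta> K x))"
      unfolding f_def G_fun_single_spin[symmetric] by (simp flip: exp_of_nat_mult)
    finally show ?thesis .
  qed
qed

lemma integrable_normal_density_abs: "\<sigma> > 0 \<Longrightarrow> integrable lborel (\<lambda>x. \<bar>x\<bar> * normal_density \<mu> \<sigma> x)"
proof -
  assume "\<sigma> > 0"
  then have "integrable lborel (\<lambda>x. \<bar>normal_density \<mu> \<sigma> x * x\<bar>)"
    by (intro integrable_abs integrable_normal_moment_nz_1)
  then show ?thesis by (simp add: abs_mult mult.commute)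
qed

text \<open>The triangle inequality inside the integral, together with the mean absolute deviation
\<open>\<sigma> sqrt (2 / pi)\<close> of the normal distribution.\<close>

lemma normal_density_abs_mean_close:
  assumes "\<sigma> > 0"
  shows "\<bar>(\<integral>x. \<bar>x\<bar> * normal_density \<mu> \<sigma> x \<partial>lborel) - \<bar>\<mu>\<bar>\<bar> \<le> \<sigma>"
proof -
  have int: "integrable lborel (\<lambda>x. normal_density \<mu> \<sigma> x * \<bar>x - \<mu>\<bar> ^ 1)"
    using assms by (intro integrable_normal_moment_abs)
  have "(\<integral>x. \<bar>x\<bar> * normal_density \<mu> \<sigma> x \<partial>lborel) - \<bar>\<mu>\<bar>
      = (\<integral>x. \<bar>x\<bar> * normal_density \<mu> \<sigma> x - \<bar>\<mu>\<bar> * normal_density \<mu> \<sigma> x \<partial>lborel)"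
    using integrable_normal_density_abs[OF assms] assms by (subst Bochner_Integration.integral_diff) auto
  also have "\<bar>\<dots>\<bar> \<le> (\<integral>x. normal_density \<mu> \<sigma> x * \<bar>x - \<mu>\<bar> ^ 1 \<partial>lborel)"
  proof (rule integral_abs_bound_integral)
    show "integrable lborel (\<lambda>x. \<bar>x\<bar> * normal_density \<mu> \<sigma> x - \<bar>\<mu>\<bar> * normal_density \<mu> \<sigma> x)"
      using integrable_normal_density_abs[OF assms] assms by auto
    show "\<bar>\<bar>x\<bar> * normal_density \<mu> \<sigma> x - \<bar>\<mu>\<bar> * normal_density \<mu> \<sigma> x\<bar> \<le> normal_density \<mu> \<sigma> x * \<bar>x - \<mu>\<bar> ^ 1" for x
    proof -
      have "\<bar>\<bar>x\<bar> * normal_density \<mu> \<sigma> x - \<bar>\<mu>\<bar> * normal_density \<mu> \<sigma> x\<bar> = normal_density \<mu> \<sigma> x * \<bar>\<bar>x\<bar> - \<bar>\<mu>\<bar>\<bar>"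
        by (simp add: abs_mult flip: left_diff_distrib)
      also have "\<dots> \<le> normal_density \<mu> \<sigma> x * \<bar>x - \<mu>\<bar> ^ 1"
        by (intro mult_left_mono) auto
      finally show ?thesis .
    qed
  qed (rule int)
  also have "\<dots> = \<sigma> * sqrt (2 / pi)"
    using integral_normal_moment_abs_odd[of \<sigma> \<mu> 0] assms by simp
  also have "\<dots> \<le> \<sigma> * 1"
    using assms pi_gt3 by (intro mult_left_mono) auto
  finally show ?thesis by simp
qed

lemma expected_abs_spin_eq:
  "expected_abs_spin n \<beta> K =
     (\<Sum>\<omega>\<in>configs n. exp (- \<beta> * hamiltonian n K \<omega>) * \<bar>total_spin n \<omega> / n\<bar>) / partition_fun n \<beta> K"
proof -
  have "expected_abs_spin n \<beta> K =
     (\<Sum>\<omega>\<in>configs n. (exp (- \<beta> * hamiltonian n K \<omega>) / partition_fun n \<beta> K) * \<bar>total_spin n \<omega> / n\<bar>)"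
    unfolding expected_abs_spin_def blume_capel_def
    using partition_fun_pos[of n \<beta> K]
    by (subst lebesgue_integral_point_measure_finite[OF finite_configs]) auto
  then show ?thesis by (simp add: sum_divide_distrib mult_ac)
qed

text \<open>Integrating the Hubbard-Stratonovich identity against \<open>1\<close> and \<open>|x|\<close> expresses the Gibbs mean as the average, over
the same configuration weights, of the absolute mean of a Gaussian around \<open>S\<^sub>n / n\<close>.\<close>

lemma expected_abs_spin_close_to_gibbs_mean:
  assumes "n > 0" "\<beta> > 0" "K > 0"
  shows "\<bar>expected_abs_spin n \<beta> K - gibbs_abs_mean (\<lambda>x. real n * G_fun \<beta> K x)\<bar> \<le> 1 / sqrt (2 * real n * \<beta> * K)"
proof -
  define \<sigma> where "\<sigma> = 1 / sqrt (2 * real n * \<beta> * K)"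
  have "\<sigma> > 0" using assms by (simp add: \<sigma>_def)
  define w where "w \<omega> = exp (- \<beta> * hamiltonian n K \<omega>)" for \<omega>
  define s where "s \<omega> = total_spin n \<omega> / n" for \<omega>
  define Z where "Z = partition_fun n \<beta> K"
  have Z: "Z > 0" "Z = (\<Sum>\<omega>\<in>configs n. w \<omega>)"
    using partition_fun_pos by (auto simp: Z_def partition_fun_def w_def)
  obtain C where "C > 0"
    and C: "\<And>x. (\<Sum>\<omega>\<in>configs n. w \<omega> * normal_density (s \<omega>) \<sigma> x) = C * exp (- (real n * G_fun \<beta> K x))"
    by (rule hubbard_stratonovich[OF assms \<sigma>_def]) (rule that, simp_all add: w_def s_def)
  have "C * (\<integral>x. exp (- (real n * G_fun \<beta> K x)) \<partial>lborel)
      = (\<integral>x. (\<Sum>\<omega>\<in>configs n. w \<omega> * normal_density (s \<omega>) \<sigma> x) \<partial>lborel)"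
    by (simp add: C)
  also have "\<dots> = (\<Sum>\<omega>\<in>configs n. w \<omega>)"
    using \<open>\<sigma> > 0\<close> by (subst Bochner_Integration.integral_sum) auto
  finally have den: "C * (\<integral>x. exp (- (real n * G_fun \<beta> K x)) \<partial>lborel) = Z" by (simp add: Z)
  define M where "M \<omega> = (\<integral>x. \<bar>x\<bar> * normal_density (s \<omega>) \<sigma> x \<partial>lborel)" for \<omega>
  have "C * (\<integral>x. \<bar>x\<bar> * exp (- (real n * G_fun \<beta> K x)) \<partial>lborel)
      = (\<integral>x. \<bar>x\<bar> * (\<Sum>\<omega>\<in>configs n. w \<omega> * normal_density (s \<omega>) \<sigma> x) \<partial>lborel)"
    by (simp add: C mult.left_commute)
  also have "\<dots> = (\<integral>x. (\<Sum>\<omega>\<in>configs n. w \<omega> * (\<bar>x\<bar> * normal_density (s \<omega>) \<sigma> x)) \<partial>lborel)"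
    by (simp add: sum_distrib_left mult_ac)
  also have "\<dots> = (\<Sum>\<omega>\<in>configs n. w \<omega> * M \<omega>)"
    unfolding M_def using \<open>\<sigma> > 0\<close> integrable_normal_density_abs
    by (subst Bochner_Integration.integral_sum) auto
  finally have num: "C * (\<integral>x. \<bar>x\<bar> * exp (- (real n * G_fun \<beta> K x)) \<partial>lborel) = (\<Sum>\<omega>\<in>configs n. w \<omega> * M \<omega>)" .
  have gibbs: "gibbs_abs_mean (\<lambda>x. real n * G_fun \<beta> K x) = (\<Sum>\<omega>\<in>configs n. w \<omega> * M \<omega>) / Z"
    unfolding gibbs_abs_mean_def den[symmetric] num[symmetric] using \<open>C > 0\<close> by simp
  have "expected_abs_spin n \<beta> K - gibbs_abs_mean (\<lambda>x. real n * G_fun \<beta> K x)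
      = (\<Sum>\<omega>\<in>configs n. w \<omega> * (\<bar>s \<omega>\<bar> - M \<omega>)) / Z"
    unfolding gibbs expected_abs_spin_eq w_def[symmetric] s_def[symmetric] Z_def[symmetric]
    by (simp add: diff_divide_distrib sum_subtractf right_diff_distrib)
  also have "\<bar>\<dots>\<bar> \<le> (\<Sum>\<omega>\<in>configs n. w \<omega> * \<sigma>) / Z"
  proof -
    have "\<bar>\<Sum>\<omega>\<in>configs n. w \<omega> * (\<bar>s \<omega>\<bar> - M \<omega>)\<bar> \<le> (\<Sum>\<omega>\<in>configs n. \<bar>w \<omega> * (\<bar>s \<omega>\<bar> - M \<omega>)\<bar>)"
      by (rule sum_abs)
    also have "\<dots> \<le> (\<Sum>\<omega>\<in>configs n. w \<omega> * \<sigma>)"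
    proof (rule sum_mono)
      fix \<omega>
      have "\<bar>\<bar>s \<omega>\<bar> - M \<omega>\<bar> \<le> \<sigma>"
        using normal_density_abs_mean_close[OF \<open>\<sigma> > 0\<close>, of "s \<omega>"] unfolding M_def by linarith
      then show "\<bar>w \<omega> * (\<bar>s \<omega>\<bar> - M \<omega>)\<bar> \<le> w \<omega> * \<sigma>" by (simp add: abs_mult w_def)
    qed
    finally show ?thesis using Z by (simp add: divide_right_mono)
  qed
  also have "\<dots> = \<sigma>" using Z by (simp flip: sum_distrib_right)
  finally show ?thesis by (simp add: \<sigma>_def)
qed

lemma gibbs_abs_mean_scale:
  assumes "r > 0"
  shows "gibbs_abs_mean f = r * gibbs_abs_mean (\<lambda>x. f (r * x))"
proof -
  have "(\<integral>x. \<bar>x\<bar> * exp (- f x) \<partial>lborel) = r * (\<integral>x. \<bar>r * x\<bar> * exp (- f (r * x)) \<partial>lborel)"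
    using lborel_integral_real_affine[of r "\<lambda>x. \<bar>x\<bar> * exp (- f x)" 0] assms by simp
  also have "(\<integral>x. \<bar>r * x\<bar> * exp (- f (r * x)) \<partial>lborel) = r * (\<integral>x. \<bar>x\<bar> * exp (- f (r * x)) \<partial>lborel)"
    using assms by (simp add: abs_mult mult.assoc)
  finally have "(\<integral>x. \<bar>x\<bar> * exp (- f x) \<partial>lborel) = r * (r * (\<integral>x. \<bar>x\<bar> * exp (- f (r * x)) \<partial>lborel))" .
  moreover have "(\<integral>x. exp (- f x) \<partial>lborel) = r * (\<integral>x. exp (- f (r * x)) \<partial>lborel)"
    using lborel_integral_real_affine[of r "\<lambda>x. exp (- f x)" 0] assms by simp
  ultimately show ?thesis using assms unfolding gibbs_abs_mean_def by simp
qed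

section \<open>Limits of Gibbs means\<close>

lemma integrable_exp_neg_square:
  assumes "k > 0"
  shows "integrable lborel (\<lambda>x::real. exp (- (k * x\<^sup>2)))"
    and "integrable lborel (\<lambda>x::real. \<bar>x\<bar> * exp (- (k * x\<^sup>2)))"
proof -
  define \<sigma> where "\<sigma> = 1 / sqrt (2 * k)"
  have "\<sigma> > 0" using assms by (simp add: \<sigma>_def)
  have "2 * \<sigma>\<^sup>2 = 1 / k" using assms by (simp add: \<sigma>_def power_divide)
  then have eq: "exp (- (k * x\<^sup>2)) = sqrt (2 * pi * \<sigma>\<^sup>2) * normal_density 0 \<sigma> x" for x
    using \<open>\<sigma> > 0\<close> by (simp add: normal_density_def mult.commute)
  show "integrable lborel (\<lambda>x::real. exp (- (k * x\<^sup>2)))"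
    unfolding eq using \<open>\<sigma> > 0\<close> by auto
  show "integrable lborel (\<lambda>x::real. \<bar>x\<bar> * exp (- (k * x\<^sup>2)))"
    unfolding eq using integrable_normal_density_abs[OF \<open>\<sigma> > 0\<close>, of 0]
    by (simp add: mult.left_commute[of "\<bar>_\<bar>"])
qed

lemma AE_lborel_not_False: "\<not> (AE x::real in lborel. False)"
proof
  assume "AE x::real in lborel. False"
  then have "emeasure lborel (UNIV :: real set) = 0" by (simp add: AE_iff_null null_sets_def)
  then show False by simp
qed

lemma integral_exp_pos:
  fixes f :: "real \<Rightarrow> real"
  assumes "integrable lborel (\<lambda>x. exp (f x))"
  shows "(\<integral>x. exp (f x) \<partial>lborel) > 0"
proof -
  have "(\<integral>x. exp (f x) \<partial>lborel) \<noteq> 0"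
    using integral_nonneg_eq_0_iff_AE[OF assms] AE_lborel_not_False by auto
  moreover have "(\<integral>x. exp (f x) \<partial>lborel) \<ge> 0" by (intro Bochner_Integration.integral_nonneg) auto
  ultimately show ?thesis by linarith
qed

lemma integral_abs_exp_pos:
  fixes f :: "real \<Rightarrow> real"
  assumes "integrable lborel (\<lambda>x. \<bar>x\<bar> * exp (f x))"
  shows "(\<integral>x. \<bar>x\<bar> * exp (f x) \<partial>lborel) > 0"
proof -
  have "(\<integral>x. \<bar>x\<bar> * exp (f x) \<partial>lborel) \<noteq> 0"
  proof
    assume "(\<integral>x. \<bar>x\<bar> * exp (f x) \<partial>lborel) = 0"
    then have "AE x in lborel. x = (0::real)"
      using integral_nonneg_eq_0_iff_AE[OF assms] by auto
    moreover have "AE x in lborel. x \<noteq> (0::real)" by (rule AE_lborel_singleton)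
    ultimately have "AE x::real in lborel. False" by eventually_elim simp
    then show False using AE_lborel_not_False by simp
  qed
  moreover have "(\<integral>x. \<bar>x\<bar> * exp (f x) \<partial>lborel) \<ge> 0" by (intro Bochner_Integration.integral_nonneg) auto
  ultimately show ?thesis by linarith
qed

lemma convex_gaussian_domination:
  assumes "strictly_convex_nonneg \<phi>" and "\<phi> 0 = 0" and "\<sigma> > 0" and "0 < h" "h \<le> \<phi> \<sigma>"
    and "\<bar>\<phi> (2 * \<sigma>) - \<phi> \<sigma>\<bar> \<le> M"
  shows "exp (- \<phi> (y\<^sup>2)) \<le> exp M * exp (- (h / \<sigma> * y\<^sup>2))"
proof -
  have "h / \<sigma> * y\<^sup>2 \<le> \<phi> \<sigma> / \<sigma> * y\<^sup>2" using assms by (intro mult_right_mono divide_right_mono) auto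
  moreover have "\<phi> (y\<^sup>2) \<ge> \<phi> \<sigma> / \<sigma> * y\<^sup>2 - \<bar>\<phi> (2 * \<sigma>) - \<phi> \<sigma>\<bar>"
    using assms by (intro convex_linear_lower_bound) auto
  ultimately show ?thesis using assms(6) by (simp flip: exp_add)
qed

lemma borel_measurable_square_comp:
  assumes "continuous_on {0..} (\<phi> :: real \<Rightarrow> real)"
  shows "(\<lambda>y. \<phi> (y\<^sup>2)) \<in> borel_measurable borel"
  by (intro borel_measurable_continuous_onI continuous_on_compose2[OF assms] continuous_intros) auto

text \<open>A convex function that vanishes at \<open>0\<close> and is positive somewhere grows at least linearly in \<open>s = y\<^sup>2\<close>.\<close>

lemma integrable_exp_convex_square:
  assumes "strictly_convex_nonneg \<phi>" and cont: "continuous_on {0..} \<phi>" and "\<phi> 0 = 0" and "\<sigma> > 0" and "\<phi> \<sigma> > 0"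
  shows "integrable lborel (\<lambda>y. exp (- \<phi> (y\<^sup>2)))" "integrable lborel (\<lambda>y. \<bar>y\<bar> * exp (- \<phi> (y\<^sup>2)))"
proof -
  define k where "k = \<phi> \<sigma> / \<sigma>"
  define C where "C = exp \<bar>\<phi> (2 * \<sigma>) - \<phi> \<sigma>\<bar>"
  note [measurable] = borel_measurable_square_comp[OF cont]
  have bound: "exp (- \<phi> (y\<^sup>2)) \<le> C * exp (- (k * y\<^sup>2))" for y
    unfolding k_def C_def using assms by (intro convex_gaussian_domination) auto
  have "k > 0" using assms by (simp add: k_def)
  note int = integrable_exp_neg_square[OF this]
  show "integrable lborel (\<lambda>y. exp (- \<phi> (y\<^sup>2)))"
    by (rule Bochner_Integration.integrable_bound[OF integrable_mult_right[OF int(1), of C]])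
       (auto intro!: AE_I2 order_trans[OF bound])
  show "integrable lborel (\<lambda>y. \<bar>y\<bar> * exp (- \<phi> (y\<^sup>2)))"
  proof (rule Bochner_Integration.integrable_bound[OF integrable_mult_right[OF int(2), of C]])
    show "AE y in lborel. norm (\<bar>y\<bar> * exp (- \<phi> (y\<^sup>2))) \<le> norm (C * (\<bar>y\<bar> * exp (- (k * y\<^sup>2))))"
    proof (rule AE_I2)
      fix y :: real
      have "\<bar>y\<bar> * exp (- \<phi> (y\<^sup>2)) \<le> \<bar>y\<bar> * (C * exp (- (k * y\<^sup>2)))" by (intro mult_left_mono bound) auto
      then show "norm (\<bar>y\<bar> * exp (- \<phi> (y\<^sup>2))) \<le> norm (C * (\<bar>y\<bar> * exp (- (k * y\<^sup>2))))"
        by (simp add: abs_mult C_def mult_ac)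
    qed
  qed auto
qed

text \<open>Dominated convergence. The dominating Gaussian comes from the values of \<open>\<Phi> n\<close> at the two points \<open>\<sigma>\<close> and
\<open>2 \<sigma>\<close>, which converge. Positivity of the limit is part of the conclusion because convergence of
\<open>n\<^sup>\<gamma> E n\<close> to \<open>L\<close> gives an asymptotic equivalence only if \<open>L \<noteq> 0\<close>.\<close>

lemma gibbs_abs_mean_tendsto:
  fixes \<Phi> :: "nat \<Rightarrow> real \<Rightarrow> real"
  assumes conv: "\<And>n. n \<ge> N \<Longrightarrow> strictly_convex_nonneg (\<Phi> n)"
    and cont: "\<And>n. n \<ge> N \<Longrightarrow> continuous_on {0..} (\<Phi> n)"
    and zero: "\<And>n. \<Phi> n 0 = 0"
    and lim: "\<And>s. s \<ge> 0 \<Longrightarrow> (\<lambda>n. \<Phi> n s) \<longlonglongrightarrow> \<Psi> s"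
    and \<sigma>: "\<sigma> > 0" "\<Psi> \<sigma> > 0"
    and mean: "\<And>n. n \<ge> N \<Longrightarrow> E n = gibbs_abs_mean (\<lambda>y. \<Phi> n (y\<^sup>2))"
  shows "E \<longlonglongrightarrow> gibbs_abs_mean (\<lambda>y. \<Psi> (y\<^sup>2))" and "gibbs_abs_mean (\<lambda>y. \<Psi> (y\<^sup>2)) > 0"
proof -
  define h M where "h = \<Psi> \<sigma> / 2" and "M = \<bar>\<Psi> (2 * \<sigma>) - \<Psi> \<sigma>\<bar> + 1"
  have h: "h > 0" "h < \<Psi> \<sigma>" using \<sigma> by (auto simp: h_def)
  have "\<forall>\<^sub>F n in sequentially. h < \<Phi> n \<sigma>"
    using \<sigma> h by (intro order_tendstoD[OF lim]) auto
  moreover have "\<forall>\<^sub>F n in sequentially. \<bar>\<Phi> n (2 * \<sigma>) - \<Phi> n \<sigma>\<bar> < M"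
    using \<sigma> by (intro order_tendstoD(2)[OF tendsto_rabs[OF tendsto_diff[OF lim lim]]]) (auto simp: M_def)
  ultimately have "\<forall>\<^sub>F n in sequentially. n \<ge> N \<and> h < \<Phi> n \<sigma> \<and> \<bar>\<Phi> n (2 * \<sigma>) - \<Phi> n \<sigma>\<bar> < M"
    using eventually_ge_at_top[of N] by eventually_elim simp
  then obtain N' where N': "\<And>n. n \<ge> N' \<Longrightarrow> n \<ge> N \<and> h < \<Phi> n \<sigma> \<and> \<bar>\<Phi> n (2 * \<sigma>) - \<Phi> n \<sigma>\<bar> < M"
    by (auto simp: eventually_sequentially)
  define k where "k = h / \<sigma>"
  have "k > 0" using h \<sigma> by (simp add: k_def)
  note int = integrable_exp_neg_square[OF this]
  have bound: "exp (- \<Phi> (n + N') (y\<^sup>2)) \<le> exp M * exp (- (k * y\<^sup>2))" for n y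
    unfolding k_def using N'[of "n + N'"] h \<sigma> zero by (intro convex_gaussian_domination conv) auto
  have meas [measurable]: "(\<lambda>y. \<Phi> (n + N') (y\<^sup>2)) \<in> borel_measurable borel" for n
    using N'[of "n + N'"] by (intro borel_measurable_square_comp cont) auto
  have pw: "(\<lambda>n. \<Phi> (n + N') (y\<^sup>2)) \<longlonglongrightarrow> \<Psi> (y\<^sup>2)" for y
    by (intro LIMSEQ_ignore_initial_segment lim) auto
  have [measurable]: "(\<lambda>y. \<Psi> (y\<^sup>2)) \<in> borel_measurable borel"
    by (rule borel_measurable_LIMSEQ_real[OF pw meas])
  have pw_exp: "(\<lambda>n. exp (- \<Phi> (n + N') (y\<^sup>2))) \<longlonglongrightarrow> exp (- \<Psi> (y\<^sup>2))"
    and pw_abs: "(\<lambda>n. \<bar>y\<bar> * exp (- \<Phi> (n + N') (y\<^sup>2))) \<longlonglongrightarrow> \<bar>y\<bar> * exp (- \<Psi> (y\<^sup>2))" for y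
    by (intro tendsto_mult tendsto_const tendsto_exp tendsto_minus pw)+
  note dom\<^sub>1 = integrable_mult_right[OF int(1), of "exp M"]
    and dom\<^sub>2 = integrable_mult_right[OF int(2), of "exp M"]
  have den: "(\<lambda>n. \<integral>y. exp (- \<Phi> (n + N') (y\<^sup>2)) \<partial>lborel) \<longlonglongrightarrow> (\<integral>y. exp (- \<Psi> (y\<^sup>2)) \<partial>lborel)"
    and den_int: "integrable lborel (\<lambda>y. exp (- \<Psi> (y\<^sup>2)))"
    by (rule integral_dominated_convergence[OF _ _ dom\<^sub>1] integrable_dominated_convergence[OF _ _ dom\<^sub>1 AE_I2[OF pw_exp]];
        use bound pw_exp in \<open>auto intro: AE_I2\<close>)+
  have dom: "norm (\<bar>y\<bar> * exp (- \<Phi> (n + N') (y\<^sup>2))) \<le> exp M * (\<bar>y\<bar> * exp (- (k * y\<^sup>2)))" for n y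
    using mult_left_mono[OF bound[of n y], of "\<bar>y\<bar>"] by (simp add: abs_mult mult_ac)
  have num: "(\<lambda>n. \<integral>y. \<bar>y\<bar> * exp (- \<Phi> (n + N') (y\<^sup>2)) \<partial>lborel) \<longlonglongrightarrow> (\<integral>y. \<bar>y\<bar> * exp (- \<Psi> (y\<^sup>2)) \<partial>lborel)"
    and num_int: "integrable lborel (\<lambda>y. \<bar>y\<bar> * exp (- \<Psi> (y\<^sup>2)))"
    by (rule integral_dominated_convergence[OF _ _ dom\<^sub>2] integrable_dominated_convergence[OF _ _ dom\<^sub>2 AE_I2[OF pw_abs]];
        use dom pw_abs in \<open>auto intro: AE_I2\<close>)+
  note pos = integral_exp_pos[OF den_int] integral_abs_exp_pos[OF num_int]
  have "(\<lambda>n. gibbs_abs_mean (\<lambda>y. \<Phi> (n + N') (y\<^sup>2))) \<longlonglongrightarrow> gibbs_abs_mean (\<lambda>y. \<Psi> (y\<^sup>2))"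
    unfolding gibbs_abs_mean_def using pos(1) by (intro tendsto_divide num den) auto
  moreover have "E (n + N') = gibbs_abs_mean (\<lambda>y. \<Phi> (n + N') (y\<^sup>2))" for n
    using N'[of "n + N'"] by (intro mean) auto
  ultimately show "E \<longlonglongrightarrow> gibbs_abs_mean (\<lambda>y. \<Psi> (y\<^sup>2))"
    by (intro LIMSEQ_offset[of E N']) simp
  show "gibbs_abs_mean (\<lambda>y. \<Psi> (y\<^sup>2)) > 0"
    unfolding gibbs_abs_mean_def using pos by simp
qed

text \<open>Laplace's principle. Outside \<open>|y\<^sup>2 - s\<^sub>0| < d\<close> the function \<open>\<Phi> n (y\<^sup>2) - \<Phi> n s\<^sub>0\<close> is at least
\<open>k |y\<^sup>2 - s\<^sub>0|\<close>, hence at least \<open>h = k d\<close>, whereas on a fixed interval next to \<open>sqrt s\<^sub>0\<close> it is at most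
\<open>h / 2\<close>. The contribution of the tail is therefore smaller than the normalization by a factor of order
\<open>exp (- a n h / 2)\<close>.\<close>

lemma gibbs_abs_mean_laplace:
  fixes \<Phi> :: "nat \<Rightarrow> real \<Rightarrow> real" and a :: "nat \<Rightarrow> real"
  assumes conv: "\<And>n. n \<ge> N \<Longrightarrow> strictly_convex_nonneg (\<Phi> n)"
    and cont: "\<And>n. n \<ge> N \<Longrightarrow> continuous_on {0..} (\<Phi> n)"
    and zero: "\<And>n. \<Phi> n 0 = 0"
    and lim: "\<And>s. s \<ge> 0 \<Longrightarrow> (\<lambda>n. \<Phi> n s) \<longlonglongrightarrow> \<Psi> s"
    and \<sigma>: "\<sigma> > 0" "\<Psi> \<sigma> > 0"
    and "s\<^sub>0 > 0" and min: "\<And>s. s \<ge> 0 \<Longrightarrow> s \<noteq> s\<^sub>0 \<Longrightarrow> \<Psi> s\<^sub>0 < \<Psi> s"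
    and cont\<Psi>: "isCont \<Psi> s\<^sub>0"
    and a: "filterlim a at_top sequentially"
    and mean: "\<And>n. n \<ge> N \<Longrightarrow> E n = gibbs_abs_mean (\<lambda>y. a n * \<Phi> n (y\<^sup>2))"
  shows "E \<longlonglongrightarrow> sqrt s\<^sub>0"
proof (rule tendstoI)
  fix e :: real assume "e > 0"
  define x\<^sub>0 where "x\<^sub>0 = sqrt s\<^sub>0"
  have x0: "x\<^sub>0 > 0" "x\<^sub>0\<^sup>2 = s\<^sub>0" using \<open>s\<^sub>0 > 0\<close> by (auto simp: x\<^sub>0_def)
  define d where "d = min (s\<^sub>0 / 2) (e * x\<^sub>0 / 2)"
  have d: "d > 0" "d < s\<^sub>0" "d \<le> e * x\<^sub>0 / 2"
    using \<open>e > 0\<close> x0 \<open>s\<^sub>0 > 0\<close> by (auto simp: d_def min_def)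
  define h where "h = min (\<Psi> (s\<^sub>0 - d) - \<Psi> s\<^sub>0) (\<Psi> (s\<^sub>0 + d) - \<Psi> s\<^sub>0) / 2"
  have "\<Psi> (s\<^sub>0 - d) > \<Psi> s\<^sub>0" "\<Psi> (s\<^sub>0 + d) > \<Psi> s\<^sub>0" using min d by auto
  then have h: "h > 0" "h < \<Psi> (s\<^sub>0 - d) - \<Psi> s\<^sub>0" "h < \<Psi> (s\<^sub>0 + d) - \<Psi> s\<^sub>0"
    by (auto simp: h_def min_def)
  define k where "k = h / d"
  have "k > 0" using h d by (simp add: k_def)
  obtain r where r: "r > 0" "\<Psi> (s\<^sub>0 + r) - \<Psi> s\<^sub>0 < h / 2"
  proof -
    have "\<forall>\<^sub>F s in at s\<^sub>0. \<Psi> s < \<Psi> s\<^sub>0 + h / 2"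
      using cont\<Psi> h by (intro order_tendstoD) (auto simp: isCont_def)
    then obtain q where q: "q > 0" "\<And>s. s \<noteq> s\<^sub>0 \<Longrightarrow> dist s s\<^sub>0 < q \<Longrightarrow> \<Psi> s < \<Psi> s\<^sub>0 + h / 2"
      by (auto simp: eventually_at)
    show thesis using q(1) q(2)[of "s\<^sub>0 + q / 2"] by (intro that[of "q / 2"]) (auto simp: dist_real_def)
  qed
  define x\<^sub>1 where "x\<^sub>1 = sqrt (s\<^sub>0 + r)"
  have x1: "x\<^sub>0 < x\<^sub>1" "x\<^sub>1\<^sup>2 = s\<^sub>0 + r" using r \<open>s\<^sub>0 > 0\<close> by (auto simp: x\<^sub>0_def x\<^sub>1_def)
  \<comment> \<open>One unit of the exponent \<open>a n\<close> is kept in the tail to make it integrable; the remaining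
     \<open>a n - 1\<close> units supply the decay.\<close>
  define tail where "tail y = \<bar>y\<^sup>2 - s\<^sub>0\<bar> / x\<^sub>0 * exp (- (k * \<bar>y\<^sup>2 - s\<^sub>0\<bar>))" for y
  have tail_nonneg: "tail y \<ge> 0" for y using x0 by (simp add: tail_def)
  have tail_int: "integrable lborel tail"
  proof (rule Bochner_Integration.integrable_bound)
    define C where "C = 2 / (k * x\<^sub>0) * exp (k / 2 * s\<^sub>0)"
    show "integrable lborel (\<lambda>y::real. C * exp (- (k / 2 * y\<^sup>2)))"
      using \<open>k > 0\<close> by (intro integrable_mult_right integrable_exp_neg_square) auto
    show "tail \<in> borel_measurable lborel" unfolding tail_def[abs_def] by measurable
    show "AE y in lborel. norm (tail y) \<le> norm (C * exp (- (k / 2 * y\<^sup>2)))"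
    proof (rule AE_I2)
      fix y :: real
      define u where "u = \<bar>y\<^sup>2 - s\<^sub>0\<bar>"
      \<comment> \<open>Half of the exponential absorbs the factor \<open>u\<close>, the other half gives the Gaussian in \<open>y\<close>.\<close>
      have "k / 2 * u \<le> exp (k / 2 * u)" using exp_ge_add_one_self[of "k / 2 * u"] by linarith
      then have "u \<le> 2 / k * exp (k / 2 * u)" using \<open>k > 0\<close> by (simp add: field_simps)
      then have "u / x\<^sub>0 * exp (- (k * u)) \<le> (2 / k * exp (k / 2 * u)) / x\<^sub>0 * exp (- (k * u))"
        using x0 by (intro mult_right_mono divide_right_mono) auto
      also have "\<dots> = 2 / (k * x\<^sub>0) * exp (- (k / 2 * u))"
        by (simp flip: exp_add)
      also have "\<dots> \<le> 2 / (k * x\<^sub>0) * exp (k / 2 * s\<^sub>0 - k / 2 * y\<^sup>2)"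
      proof -
        have "k / 2 * (y\<^sup>2 - s\<^sub>0) \<le> k / 2 * u" using \<open>k > 0\<close> by (intro mult_left_mono) (auto simp: u_def)
        then have "- (k / 2 * u) \<le> k / 2 * s\<^sub>0 - k / 2 * y\<^sup>2" unfolding right_diff_distrib by linarith
        then show ?thesis using \<open>k > 0\<close> x0 by (intro mult_left_mono) auto
      qed
      also have "\<dots> = C * exp (- (k / 2 * y\<^sup>2))" by (simp add: C_def flip: exp_add)
      finally show "norm (tail y) \<le> norm (C * exp (- (k / 2 * y\<^sup>2)))"
        using tail_nonneg[of y] unfolding tail_def u_def[symmetric] by simp
    qed
  qed
  define T where "T = (\<integral>y. tail y \<partial>lborel)"
  have small: "\<forall>\<^sub>F n in sequentially. exp (- (a n - 1) * h) * T < e / 2 * ((x\<^sub>1 - x\<^sub>0) * exp (- (a n * (h / 2))))"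
  proof -
    have "((\<lambda>a. exp (h - a * (h / 2)) * T) \<longlongrightarrow> 0) at_top"
      using h(1) by real_asymp
    then have "(\<lambda>n. exp (h - a n * (h / 2)) * T) \<longlonglongrightarrow> 0"
      using a by (rule filterlim_compose)
    then have "\<forall>\<^sub>F n in sequentially. exp (h - a n * (h / 2)) * T < e / 2 * (x\<^sub>1 - x\<^sub>0)"
      using \<open>e > 0\<close> x1 by (intro order_tendstoD) auto
    then show ?thesis
    proof eventually_elim
      case (elim n)
      have "exp (- (a n - 1) * h) * T = exp (- (a n * (h / 2))) * (exp (h - a n * (h / 2)) * T)"
        by (simp add: algebra_simps flip: exp_add mult.assoc)
      also have "\<dots> < exp (- (a n * (h / 2))) * (e / 2 * (x\<^sub>1 - x\<^sub>0))"
        using elim by (intro mult_strict_left_mono) auto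
      finally show ?case by (simp add: mult_ac)
    qed
  qed
  have "\<forall>\<^sub>F n in sequentially. h < \<Phi> n (s\<^sub>0 - d) - \<Phi> n s\<^sub>0"
    using d h by (intro order_tendstoD[OF tendsto_diff[OF lim lim]]) auto
  moreover have "\<forall>\<^sub>F n in sequentially. h < \<Phi> n (s\<^sub>0 + d) - \<Phi> n s\<^sub>0"
    using d h by (intro order_tendstoD[OF tendsto_diff[OF lim lim]]) auto
  moreover have "\<forall>\<^sub>F n in sequentially. \<Phi> n (s\<^sub>0 + r) - \<Phi> n s\<^sub>0 < h / 2"
    using \<open>s\<^sub>0 > 0\<close> r by (intro order_tendstoD[OF tendsto_diff[OF lim lim]]) auto
  moreover have "\<forall>\<^sub>F n in sequentially. 0 < \<Phi> n \<sigma>"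
    using \<sigma> by (intro order_tendstoD[OF lim]) auto
  moreover have "\<forall>\<^sub>F n in sequentially. a n \<ge> 1"
    using a by (simp add: filterlim_at_top)
  ultimately show "\<forall>\<^sub>F n in sequentially. dist (E n) (sqrt s\<^sub>0) < e"
    using small eventually_ge_at_top[of N]
  proof eventually_elim
    case (elim n)
    note cvx = conv[OF \<open>n \<ge> N\<close>]
    define D where "D y = \<Phi> n (y\<^sup>2) - \<Phi> n s\<^sub>0" for y
    have "strictly_convex_nonneg (\<lambda>s. a n * \<Phi> n (1 * s))"
      using elim by (intro strictly_convex_nonneg_rescale cvx) auto
    moreover have "continuous_on {0..} (\<lambda>s. a n * \<Phi> n s)"
      using cont[OF \<open>n \<ge> N\<close>] by (intro continuous_on_mult continuous_on_const)
    ultimately have int: "integrable lborel (\<lambda>y. exp (- (a n * \<Phi> n (y\<^sup>2))))"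
      "integrable lborel (\<lambda>y. \<bar>y\<bar> * exp (- (a n * \<Phi> n (y\<^sup>2))))"
      using integrable_exp_convex_square[of "\<lambda>s. a n * \<Phi> n s" \<sigma>] elim zero \<sigma> by simp_all
    \<comment> \<open>Subtracting the value at \<open>s\<^sub>0\<close> changes numerator and denominator by the same factor.\<close>
    define w where "w y = exp (- (a n * D y))" for y
    have w_eq: "w y = exp (a n * \<Phi> n s\<^sub>0) * exp (- (a n * \<Phi> n (y\<^sup>2)))" for y
      by (simp add: w_def D_def algebra_simps flip: exp_add)
    have w_int: "integrable lborel w" "integrable lborel (\<lambda>y. \<bar>y\<bar> * w y)"
      using integrable_mult_right[OF int(1), of "exp (a n * \<Phi> n s\<^sub>0)"]
        integrable_mult_right[OF int(2), of "exp (a n * \<Phi> n s\<^sub>0)"]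
      by (simp_all add: w_eq[abs_def] mult_ac)
    define Z where "Z = (\<integral>y. w y \<partial>lborel)"
    have E: "E n = (\<integral>y. \<bar>y\<bar> * w y \<partial>lborel) / Z"
    proof -
      have "(\<integral>y. \<bar>y\<bar> * w y \<partial>lborel) = exp (a n * \<Phi> n s\<^sub>0) * (\<integral>y. \<bar>y\<bar> * exp (- (a n * \<Phi> n (y\<^sup>2))) \<partial>lborel)"
        by (simp add: w_eq mult.left_commute[of "\<bar>_\<bar>"])
      moreover have "Z = exp (a n * \<Phi> n s\<^sub>0) * (\<integral>y. exp (- (a n * \<Phi> n (y\<^sup>2))) \<partial>lborel)"
        by (simp add: Z_def w_eq)
      ultimately show ?thesis using mean[OF \<open>n \<ge> N\<close>] by (simp add: gibbs_abs_mean_def)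
    qed
    \<comment> \<open>The normalization is bounded below by the mass between \<open>x\<^sub>0\<close> and \<open>x\<^sub>1\<close>.\<close>
    have Z_ge: "(x\<^sub>1 - x\<^sub>0) * exp (- (a n * (h / 2))) \<le> Z"
    proof -
      have "(x\<^sub>1 - x\<^sub>0) * exp (- (a n * (h / 2))) = (\<integral>y. indicator {x\<^sub>0..x\<^sub>1} y * exp (- (a n * (h / 2))) \<partial>lborel)"
        using x1 by simp
      also have "\<dots> \<le> Z" unfolding Z_def
      proof (rule integral_mono)
        show "indicator {x\<^sub>0..x\<^sub>1} y * exp (- (a n * (h / 2))) \<le> w y" for y
        proof (cases "y \<in> {x\<^sub>0..x\<^sub>1}")
          case True
          then have "x\<^sub>0\<^sup>2 \<le> y\<^sup>2" "y\<^sup>2 \<le> x\<^sub>1\<^sup>2" using x0 by (auto intro!: power_mono)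
          then have "\<Phi> n (y\<^sup>2) \<le> max (\<Phi> n s\<^sub>0) (\<Phi> n (s\<^sub>0 + r))"
            using x0 x1 \<open>s\<^sub>0 > 0\<close> by (intro convex_below_inside[OF cvx]) auto
          then have "D y \<le> h / 2" using elim h unfolding D_def by linarith
          then show ?thesis using True elim by (simp add: w_def mult_left_mono)
        qed (simp add: w_def)
      qed (use w_int x1(1) in \<open>auto intro!: integrable_mult_left integrable_real_indicator\<close>)
      finally show ?thesis .
    qed
    then have "Z > 0" using x1 by (smt (verit) exp_gt_zero mult_pos_pos)
    have dev: "\<bar>\<bar>y\<bar> - x\<^sub>0\<bar> * w y \<le> e / 2 * w y + exp (- (a n - 1) * h) * tail y" for y
    proof -
      have "\<bar>\<bar>y\<bar> - x\<^sub>0\<bar> * x\<^sub>0 \<le> \<bar>\<bar>y\<bar> - x\<^sub>0\<bar> * (\<bar>y\<bar> + x\<^sub>0)" using x0 by (intro mult_left_mono) auto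
      also have "\<dots> = \<bar>(\<bar>y\<bar> - x\<^sub>0) * (\<bar>y\<bar> + x\<^sub>0)\<bar>" using x0 by (simp add: abs_mult)
      also have "(\<bar>y\<bar> - x\<^sub>0) * (\<bar>y\<bar> + x\<^sub>0) = y\<^sup>2 - s\<^sub>0"
        unfolding x0(2)[symmetric] by (simp add: algebra_simps power2_eq_square)
      finally have dist: "\<bar>\<bar>y\<bar> - x\<^sub>0\<bar> \<le> \<bar>y\<^sup>2 - s\<^sub>0\<bar> / x\<^sub>0" using x0 by (simp add: field_simps)
      show ?thesis
      proof (cases "\<bar>y\<^sup>2 - s\<^sub>0\<bar> < d")
        case True
        then have "\<bar>y\<^sup>2 - s\<^sub>0\<bar> / x\<^sub>0 \<le> e / 2" using d x0 by (simp add: field_simps)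
        with dist have "\<bar>\<bar>y\<bar> - x\<^sub>0\<bar> \<le> e / 2" by (rule order_trans)
        then have "\<bar>\<bar>y\<bar> - x\<^sub>0\<bar> * w y \<le> e / 2 * w y" by (intro mult_right_mono) (auto simp: w_def)
        then show ?thesis using tail_nonneg[of y] by (simp add: add_increasing2)
      next
        case False
        define u where "u = \<bar>y\<^sup>2 - s\<^sub>0\<bar>"
        have "\<Phi> n (y\<^sup>2) \<ge> \<Phi> n s\<^sub>0 + h / d * \<bar>y\<^sup>2 - s\<^sub>0\<bar>"
          using False d h elim by (intro convex_above_outside[OF cvx]) auto
        then have "k * u \<le> D y" by (simp add: D_def k_def u_def)
        then have "a n * (k * u) \<le> a n * D y" using elim by (intro mult_left_mono) auto
        moreover have "(a n - 1) * h \<le> (a n - 1) * (k * u)"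
        proof (rule mult_left_mono)
          have "k * d \<le> k * u" using False \<open>k > 0\<close> by (intro mult_left_mono) (auto simp: u_def)
          then show "h \<le> k * u" using d by (simp add: k_def)
        qed (use elim in auto)
        ultimately have "w y \<le> exp (- (a n - 1) * h) * exp (- (k * u))"
          unfolding w_def exp_add[symmetric] by (simp add: algebra_simps)
        then have "\<bar>\<bar>y\<bar> - x\<^sub>0\<bar> * w y \<le> (u / x\<^sub>0) * (exp (- (a n - 1) * h) * exp (- (k * u)))"
          using dist x0 unfolding u_def by (intro mult_mono) (auto simp: w_def)
        also have "\<dots> = exp (- (a n - 1) * h) * tail y" by (simp add: tail_def u_def)
        finally show ?thesis using \<open>e > 0\<close> by (simp add: w_def add_increasing)
      qed
    qed
    have "\<bar>E n - x\<^sub>0\<bar> = \<bar>\<integral>y. (\<bar>y\<bar> - x\<^sub>0) * w y \<partial>lborel\<bar> / Z"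
    proof -
      have "(\<integral>y. (\<bar>y\<bar> - x\<^sub>0) * w y \<partial>lborel) = (\<integral>y. \<bar>y\<bar> * w y \<partial>lborel) - x\<^sub>0 * Z"
        unfolding Z_def left_diff_distrib using w_int by (subst Bochner_Integration.integral_diff) auto
      then have "E n - x\<^sub>0 = (\<integral>y. (\<bar>y\<bar> - x\<^sub>0) * w y \<partial>lborel) / Z"
        using \<open>Z > 0\<close> by (simp add: E field_simps)
      then show ?thesis using \<open>Z > 0\<close> by simp
    qed
    also have "\<bar>\<integral>y. (\<bar>y\<bar> - x\<^sub>0) * w y \<partial>lborel\<bar> \<le> (\<integral>y. e / 2 * w y + exp (- (a n - 1) * h) * tail y \<partial>lborel)"
    proof (rule integral_abs_bound_integral)
      show "integrable lborel (\<lambda>y. (\<bar>y\<bar> - x\<^sub>0) * w y)"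
        unfolding left_diff_distrib using w_int by auto
      show "integrable lborel (\<lambda>y. e / 2 * w y + exp (- (a n - 1) * h) * tail y)"
        using w_int tail_int by auto
      show "\<bar>(\<bar>y\<bar> - x\<^sub>0) * w y\<bar> \<le> e / 2 * w y + exp (- (a n - 1) * h) * tail y" for y
        using dev[of y] by (simp add: abs_mult w_def)
    qed
    also have "\<dots> = e / 2 * Z + exp (- (a n - 1) * h) * T"
      unfolding Z_def T_def using w_int tail_int by (subst Bochner_Integration.integral_add) auto
    also have "\<dots> < e / 2 * Z + e / 2 * ((x\<^sub>1 - x\<^sub>0) * exp (- (a n * (h / 2))))"
      using elim by simp
    also have "\<dots> \<le> e / 2 * Z + e / 2 * Z"
      using Z_ge \<open>e > 0\<close> by (intro add_left_mono mult_left_mono) auto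
    also have "\<dots> = e * Z" by simp
    finally have "\<bar>E n - x\<^sub>0\<bar> < e" using \<open>Z > 0\<close> by (simp add: divide_right_mono divide_strict_right_mono)
    then show ?case by (simp add: dist_real_def x\<^sub>0_def)
  qed
qed

section \<open>Quartic expansion of the free-energy functional\<close>

text \<open>The coefficient of \<open>x\<^sup>2\<close> in the expansion of \<open>G\<close> at \<open>0\<close>, in the form that shows that it changes sign
on the curve \<open>K = K(\<beta>)\<close>.\<close>

definition quad_coeff :: "real \<Rightarrow> real \<Rightarrow> real" where
  "quad_coeff \<beta> K = \<beta> * K * (K_curve \<beta> - K) / K_curve \<beta>"

lemma c_fun_cosh: "c_fun \<beta> t = ln (1 + 2 / (exp \<beta> + 2) * (cosh t - 1))"
proof -
  have pos: "1 + 2 * exp (- \<beta>) > 0" "exp \<beta> + 2 > 0" by (auto intro!: add_pos_pos)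
  have "(1 + exp (- \<beta>) * (exp t + exp (- t))) / (1 + 2 * exp (- \<beta>))
      = (exp \<beta> * (1 + exp (- \<beta>) * (2 * cosh t))) / (exp \<beta> * (1 + 2 * exp (- \<beta>)))"
    by (simp add: cosh_field_def)
  also have "\<dots> = (exp \<beta> + 2 * cosh t) / (exp \<beta> + 2)"
  proof -
    have "exp \<beta> * (1 + exp (- \<beta>) * z) = exp \<beta> + z" for z
      by (simp add: distrib_left exp_minus)
    from this[of "2 * cosh t"] this[of 2] show ?thesis by (simp only: mult.commute[of 2 "exp (- \<beta>)"])
  qed
  also have "\<dots> = 1 + 2 / (exp \<beta> + 2) * (cosh t - 1)"
    using pos by (simp add: field_simps)
  finally show ?thesis by (simp add: c_fun_def)
qed

lemma quartic_collect: "L * (Y * (k * X)) - q * C * (k * X) = k * (L * Y - q * C) * (X::real)"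
  by (simp add: algebra_simps)

text \<open>With \<open>y = q (cosh t - 1)\<close> the logarithm is \<open>ln (1 + y)\<close>. The quartic remainder splits into the second-order
term of the logarithm and the fourth-order term of \<open>cosh\<close>, each a quotient in one variable; the dependence on the
parameters is then through the continuous factors \<open>q\<close> and \<open>2 \<beta> K\<close> only.\<close>

lemma G_fun_minus_quadratic:
  assumes "\<beta> > 0" and "x \<noteq> 0" and "K > 0"
  defines "q \<equiv> 2 / (exp \<beta> + 2)" and "t \<equiv> 2 * \<beta> * K * x"
  defines "y \<equiv> q * (cosh t - 1)"
  shows "(G_fun \<beta> K x - quad_coeff \<beta> K * x\<^sup>2) / x ^ 4
    = (2 * \<beta> * K) ^ 4 * ((y - ln (1 + y)) / y\<^sup>2 * (q * ((cosh t - 1) / t\<^sup>2))\<^sup>2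
                           - q * ((cosh t - 1 - t\<^sup>2 / 2) / t ^ 4))"
    and "y > 0"
proof -
  have "exp \<beta> + 2 > 0" by (intro add_pos_pos) auto
  then have "q > 0" by (simp add: q_def)
  have "t \<noteq> 0" using assms by (simp add: t_def)
  then have "cosh t > 1" using cosh_real_nonneg_less_iff[of 0 "\<bar>t\<bar>"] by simp
  then show "y > 0" using \<open>q > 0\<close> by (simp add: y_def)
  have curve: "1 / K_curve \<beta> = 2 * \<beta> * q"
    using \<open>exp \<beta> + 2 > 0\<close> by (simp add: K_curve_def q_def)
  have "K_curve \<beta> > 0" using \<open>exp \<beta> + 2 > 0\<close> \<open>\<beta> > 0\<close> by (simp add: K_curve_def)
  then have "\<beta> * K - quad_coeff \<beta> K = \<beta> * K * K * (1 / K_curve \<beta>)"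
    by (simp add: quad_coeff_def field_simps)
  then have "\<beta> * K * x\<^sup>2 - quad_coeff \<beta> K * x\<^sup>2 = \<beta> * K * K * (2 * \<beta> * q) * x\<^sup>2"
    unfolding curve left_diff_distrib[symmetric] by simp
  also have "\<dots> = q * t\<^sup>2 / 2" by (simp add: t_def power2_eq_square)
  finally have "G_fun \<beta> K x - quad_coeff \<beta> K * x\<^sup>2 = q * t\<^sup>2 / 2 - ln (1 + y)"
    unfolding G_fun_def c_fun_cosh y_def q_def t_def by simp
  also have "\<dots> = (y - ln (1 + y)) - q * (cosh t - 1 - t\<^sup>2 / 2)"
    by (simp add: y_def algebra_simps)
  also have "\<dots> = (y - ln (1 + y)) / y\<^sup>2 * y\<^sup>2 - q * ((cosh t - 1 - t\<^sup>2 / 2) / t ^ 4) * t ^ 4"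
    using \<open>y > 0\<close> \<open>t \<noteq> 0\<close> by simp
  finally have split: "G_fun \<beta> K x - quad_coeff \<beta> K * x\<^sup>2
      = (y - ln (1 + y)) / y\<^sup>2 * y\<^sup>2 - q * ((cosh t - 1 - t\<^sup>2 / 2) / t ^ 4) * t ^ 4" .
  have y2: "y\<^sup>2 = (q * ((cosh t - 1) / t\<^sup>2))\<^sup>2 * t ^ 4"
    using \<open>t \<noteq> 0\<close> by (simp add: y_def power_mult_distrib power_divide flip: power_mult)
  have t4: "t ^ 4 = (2 * \<beta> * K) ^ 4 * x ^ 4" unfolding t_def by (rule power_mult_distrib)
  define L C Y where "L = (y - ln (1 + y)) / y\<^sup>2" and "C = (cosh t - 1 - t\<^sup>2 / 2) / t ^ 4"
    and "Y = (q * ((cosh t - 1) / t\<^sup>2))\<^sup>2"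
  have "G_fun \<beta> K x - quad_coeff \<beta> K * x\<^sup>2 = L * (Y * t ^ 4) - q * C * t ^ 4"
    using split y2 by (simp only: L_def C_def Y_def)
  also have "\<dots> = (2 * \<beta> * K) ^ 4 * (L * Y - q * C) * x ^ 4"
    unfolding t4 by (rule quartic_collect)
  finally have factored: "G_fun \<beta> K x - quad_coeff \<beta> K * x\<^sup>2 = (2 * \<beta> * K) ^ 4 * (L * Y - q * C) * x ^ 4" .
  have "x ^ 4 \<noteq> 0" using \<open>x \<noteq> 0\<close> by simp
  then have "(G_fun \<beta> K x - quad_coeff \<beta> K * x\<^sup>2) / x ^ 4 = (2 * \<beta> * K) ^ 4 * (L * Y - q * C)"
    unfolding factored by (rule nonzero_mult_div_cancel_right)
  then show "(G_fun \<beta> K x - quad_coeff \<beta> K * x\<^sup>2) / x ^ 4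
    = (2 * \<beta> * K) ^ 4 * ((y - ln (1 + y)) / y\<^sup>2 * (q * ((cosh t - 1) / t\<^sup>2))\<^sup>2
                           - q * ((cosh t - 1 - t\<^sup>2 / 2) / t ^ 4))"
    unfolding L_def C_def Y_def .
qed

text \<open>At \<open>\<beta> = \<beta>\<^sub>0\<close> and \<open>K = K(\<beta>\<^sub>0)\<close> one has \<open>2 \<beta> K = 1 / q\<close>, and the limit is \<open>q\<^bsup>-4\<^esup> (q\<^sup>2 / 8 - q / 24)\<close>, which is \<open>c4 \<beta>\<^sub>0\<close> for
\<open>q = 2 / (exp \<beta>\<^sub>0 + 2)\<close>.\<close>

lemma G_fun_quartic_limit:
  assumes "\<beta>\<^sub>0 > 0"
    and \<beta>: "\<beta> \<longlonglongrightarrow> \<beta>\<^sub>0" and K: "K \<longlonglongrightarrow> K_curve \<beta>\<^sub>0"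
    and x: "x \<longlonglongrightarrow> 0" and x_nz: "\<forall>\<^sub>F n in sequentially. x n \<noteq> 0"
  shows "(\<lambda>n. (G_fun (\<beta> n) (K n) (x n) - quad_coeff (\<beta> n) (K n) * (x n)\<^sup>2) / x n ^ 4) \<longlonglongrightarrow> c4 \<beta>\<^sub>0"
proof -
  have e2: "exp b + 2 > 0" for b :: real by (intro add_pos_pos) auto
  have K0: "K_curve \<beta>\<^sub>0 > 0" using e2[of \<beta>\<^sub>0] \<open>\<beta>\<^sub>0 > 0\<close> by (simp add: K_curve_def)
  have pos: "\<forall>\<^sub>F n in sequentially. \<beta> n > 0" "\<forall>\<^sub>F n in sequentially. K n > 0"
    by (rule order_tendstoD[OF \<beta>] order_tendstoD[OF K]; fact)+
  define q where "q n = 2 / (exp (\<beta> n) + 2)" for n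
  define t where "t n = 2 * \<beta> n * K n * x n" for n
  define y where "y n = q n * (cosh (t n) - 1)" for n
  have q: "q \<longlonglongrightarrow> 2 / (exp \<beta>\<^sub>0 + 2)"
    unfolding q_def[abs_def] using e2[of \<beta>\<^sub>0] by (intro tendsto_intros \<beta>) auto
  have t0: "t \<longlonglongrightarrow> 0"
    unfolding t_def[abs_def]
    using tendsto_mult[OF tendsto_mult[OF tendsto_mult[OF tendsto_const[of 2] \<beta>] K] x] by simp
  have nz: "\<forall>\<^sub>F n in sequentially. x n \<noteq> 0 \<and> \<beta> n > 0 \<and> K n > 0"
    using x_nz pos by eventually_elim simp
  have "\<forall>\<^sub>F n in sequentially. t n \<noteq> 0"
    using nz by eventually_elim (simp add: t_def)
  then have t: "filterlim t (at 0) sequentially"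
    using t0 by (simp add: filterlim_at)
  have "y \<longlonglongrightarrow> 2 / (exp \<beta>\<^sub>0 + 2) * (cosh 0 - 1)"
    unfolding y_def[abs_def] by (intro tendsto_intros q t0)
  moreover have "\<forall>\<^sub>F n in sequentially. y n > 0"
    using nz by eventually_elim (use G_fun_minus_quadratic(2) in \<open>simp add: y_def q_def t_def\<close>)
  ultimately have y: "filterlim y (at_right 0) sequentially"
    by (simp add: filterlim_at eventually_mono)
  have "((\<lambda>t::real. (cosh t - 1) / t\<^sup>2) \<longlongrightarrow> 1 / 2) (at 0)" by real_asymp
  then have lim1: "(\<lambda>n. (cosh (t n) - 1) / (t n)\<^sup>2) \<longlonglongrightarrow> 1 / 2" using t by (rule filterlim_compose)
  have "((\<lambda>t::real. (cosh t - 1 - t\<^sup>2 / 2) / t ^ 4) \<longlongrightarrow> 1 / 24) (at 0)" by real_asymp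
  then have lim2: "(\<lambda>n. (cosh (t n) - 1 - (t n)\<^sup>2 / 2) / t n ^ 4) \<longlonglongrightarrow> 1 / 24" using t by (rule filterlim_compose)
  have "((\<lambda>y::real. (y - ln (1 + y)) / y\<^sup>2) \<longlongrightarrow> 1 / 2) (at_right 0)" by real_asymp
  then have lim3: "(\<lambda>n. (y n - ln (1 + y n)) / (y n)\<^sup>2) \<longlonglongrightarrow> 1 / 2" using y by (rule filterlim_compose)
  define e where "e = exp \<beta>\<^sub>0 + 2"
  have "(\<lambda>n. (2 * \<beta> n * K n) ^ 4 * ((y n - ln (1 + y n)) / (y n)\<^sup>2 * (q n * ((cosh (t n) - 1) / (t n)\<^sup>2))\<^sup>2
            - q n * ((cosh (t n) - 1 - (t n)\<^sup>2 / 2) / t n ^ 4)))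
        \<longlonglongrightarrow> (2 * \<beta>\<^sub>0 * K_curve \<beta>\<^sub>0) ^ 4 * (1 / 2 * (2 / (exp \<beta>\<^sub>0 + 2) * (1 / 2))\<^sup>2 - 2 / (exp \<beta>\<^sub>0 + 2) * (1 / 24))"
    by (intro tendsto_mult tendsto_power tendsto_diff tendsto_const \<beta> K q lim1 lim2 lim3)
  also have "(2 * \<beta>\<^sub>0 * K_curve \<beta>\<^sub>0) ^ 4 * (1 / 2 * (2 / (exp \<beta>\<^sub>0 + 2) * (1 / 2))\<^sup>2 - 2 / (exp \<beta>\<^sub>0 + 2) * (1 / 24)) = c4 \<beta>\<^sub>0"
  proof -
    have "2 * \<beta>\<^sub>0 * K_curve \<beta>\<^sub>0 = e / 2" using \<open>\<beta>\<^sub>0 > 0\<close> by (simp add: K_curve_def e_def)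
    moreover have "c4 \<beta>\<^sub>0 = e\<^sup>2 * (6 - e) / 192" by (simp add: c4_def e_def fact_numeral)
    moreover have "(e / 2) ^ 4 * (1 / 2 * (2 / e * (1 / 2))\<^sup>2 - 2 / e * (1 / 24)) = e\<^sup>2 * (6 - e) / 192"
      using e2[of \<beta>\<^sub>0] unfolding e_def[symmetric] by (simp add: field_simps power2_eq_square power4_eq_xxxx)
    ultimately show ?thesis unfolding e_def[symmetric] by (simp only:)
  qed
  finally show ?thesis
  proof (rule Lim_transform_eventually)
    show "\<forall>\<^sub>F n in sequentially. (2 * \<beta> n * K n) ^ 4 * ((y n - ln (1 + y n)) / (y n)\<^sup>2 * (q n * ((cosh (t n) - 1) / (t n)\<^sup>2))\<^sup>2
            - q n * ((cosh (t n) - 1 - (t n)\<^sup>2 / 2) / t n ^ 4))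
        = (G_fun (\<beta> n) (K n) (x n) - quad_coeff (\<beta> n) (K n) * (x n)\<^sup>2) / x n ^ 4"
      using nz by eventually_elim (simp add: G_fun_minus_quadratic(1) y_def q_def t_def)
  qed
qed

lemma G_fun_scaling_limit:
  assumes "\<beta>\<^sub>0 > 0" and \<beta>: "\<beta> \<longlonglongrightarrow> \<beta>\<^sub>0" and K: "K \<longlonglongrightarrow> K_curve \<beta>\<^sub>0"
    and r: "r \<longlonglongrightarrow> 0" "\<forall>\<^sub>F n in sequentially. r n > 0"
    and quartic: "(\<lambda>n. a n * r n ^ 4) \<longlonglongrightarrow> 1"
    and quadratic: "(\<lambda>n. a n * (r n)\<^sup>2 * quad_coeff (\<beta> n) (K n)) \<longlonglongrightarrow> A"
    and "s \<ge> 0"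
  shows "(\<lambda>n. a n * G_fun (\<beta> n) (K n) (r n * sqrt s)) \<longlonglongrightarrow> A * s + c4 \<beta>\<^sub>0 * s\<^sup>2"
proof (cases "s = 0")
  case True
  then show ?thesis by (simp add: G_fun_0)
next
  case False
  then have "s > 0" using \<open>s \<ge> 0\<close> by simp
  define x where "x n = r n * sqrt s" for n
  have x: "x \<longlonglongrightarrow> 0" "\<forall>\<^sub>F n in sequentially. x n \<noteq> 0"
    unfolding x_def[abs_def] using r \<open>s > 0\<close>
    by (auto intro: tendsto_mult_left_zero elim: eventually_mono)
  have "(\<lambda>n. a n * (r n)\<^sup>2 * quad_coeff (\<beta> n) (K n) * s
           + a n * r n ^ 4 * ((G_fun (\<beta> n) (K n) (x n) - quad_coeff (\<beta> n) (K n) * (x n)\<^sup>2) / x n ^ 4) * s\<^sup>2)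
        \<longlonglongrightarrow> A * s + 1 * c4 \<beta>\<^sub>0 * s\<^sup>2"
    by (intro tendsto_add tendsto_mult tendsto_const quadratic quartic G_fun_quartic_limit[OF assms(1) \<beta> K x])
  then have "(\<lambda>n. a n * (r n)\<^sup>2 * quad_coeff (\<beta> n) (K n) * s
           + a n * r n ^ 4 * ((G_fun (\<beta> n) (K n) (x n) - quad_coeff (\<beta> n) (K n) * (x n)\<^sup>2) / x n ^ 4) * s\<^sup>2)
        \<longlonglongrightarrow> A * s + c4 \<beta>\<^sub>0 * s\<^sup>2" by simp
  then show ?thesis
  proof (rule Lim_transform_eventually)
    show "\<forall>\<^sub>F n in sequentially. a n * (r n)\<^sup>2 * quad_coeff (\<beta> n) (K n) * s
           + a n * r n ^ 4 * ((G_fun (\<beta> n) (K n) (x n) - quad_coeff (\<beta> n) (K n) * (x n)\<^sup>2) / x n ^ 4) * s\<^sup>2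
        = a n * G_fun (\<beta> n) (K n) (r n * sqrt s)"
      using r(2)
    proof eventually_elim
      case (elim n)
      have x2: "(x n)\<^sup>2 = (r n)\<^sup>2 * s" using \<open>s > 0\<close> by (simp add: x_def power_mult_distrib)
      have "x n ^ 4 = ((x n)\<^sup>2)\<^sup>2" by (simp flip: power_mult)
      also have "\<dots> = r n ^ 4 * s\<^sup>2" unfolding x2 by (simp add: power_mult_distrib flip: power_mult)
      finally have x4: "x n ^ 4 = r n ^ 4 * s\<^sup>2" .
      define R where "R = G_fun (\<beta> n) (K n) (x n) - quad_coeff (\<beta> n) (K n) * (x n)\<^sup>2"
      have "a n * r n ^ 4 * (R / x n ^ 4) * s\<^sup>2 = a n * R"
        unfolding x4 using elim \<open>s > 0\<close> by simp
      moreover have "a n * (r n)\<^sup>2 * quad_coeff (\<beta> n) (K n) * s = a n * (quad_coeff (\<beta> n) (K n) * (x n)\<^sup>2)"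
        unfolding x2 by simp
      moreover have "a n * (quad_coeff (\<beta> n) (K n) * (x n)\<^sup>2) + a n * R = a n * G_fun (\<beta> n) (K n) (r n * sqrt s)"
        unfolding R_def distrib_left[symmetric] by (simp add: x_def)
      ultimately show ?case unfolding R_def[symmetric] by (simp only:)
    qed
  qed
qed

section \<open>The parameter sequence\<close>

text \<open>This form is preserved by differentiation on the positive half-line and yields that \<open>K_curve\<close> is smooth there.\<close>

lemma K_deriv_closed_form: "\<exists>P c. \<forall>x>0. K_deriv j x = (exp x * poly P x + c) / x ^ Suc j"
proof (induction j)
  case 0
  have "\<forall>x>0. K_deriv 0 x = (exp x * poly [:1 / 4:] x + 1 / 2) / x ^ Suc 0"
    by (simp add: K_curve_def field_simps)
  then show ?case by blast
next
  case (Suc j)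
  then obtain P c where IH: "\<And>x. x > 0 \<Longrightarrow> K_deriv j x = (exp x * poly P x + c) / x ^ Suc j" by blast
  define k where "k = real (Suc j)"
  define Q where "Q = pCons 0 (P + pderiv P) - smult k P"
  have "K_deriv (Suc j) x = (exp x * poly Q x + (- k * c)) / x ^ Suc (Suc j)" if "x > 0" for x
  proof -
    have "((\<lambda>x. exp x * poly P x + c) has_real_derivative exp x * poly P x + exp x * poly (pderiv P) x) (at x)"
      by (auto intro!: derivative_eq_intros poly_DERIV)
    moreover have "((\<lambda>x. x ^ Suc j) has_real_derivative k * x ^ j) (at x)"
      by (rule DERIV_pow[THEN DERIV_cong]) (simp add: k_def)
    ultimately have "((\<lambda>x. (exp x * poly P x + c) / x ^ Suc j) has_real_derivative
        ((exp x * poly P x + exp x * poly (pderiv P) x) * x ^ Suc j - (exp x * poly P x + c) * (k * x ^ j))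
          / (x ^ Suc j * x ^ Suc j)) (at x)"
      by (rule DERIV_divide) (use that in simp)
    also have "(exp x * poly P x + exp x * poly (pderiv P) x) * x ^ Suc j - (exp x * poly P x + c) * (k * x ^ j)
        = x ^ j * (exp x * poly Q x + (- k * c))"
      by (simp add: Q_def algebra_simps)
    also have "x ^ Suc j * x ^ Suc j = x ^ j * x ^ Suc (Suc j)" by (simp add: mult_ac)
    also have "x ^ j * (exp x * poly Q x + (- k * c)) / (x ^ j * x ^ Suc (Suc j))
        = (exp x * poly Q x + (- k * c)) / x ^ Suc (Suc j)"
      by (rule mult_divide_mult_cancel_left) (use that in simp)
    finally have "(K_deriv j has_real_derivative (exp x * poly Q x + (- k * c)) / x ^ Suc (Suc j)) (at x)"
      by (rule has_field_derivative_transform_within_open[where S = "{0<..}"]) (use that IH in auto)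
    then show ?thesis by (simp add: DERIV_imp_deriv)
  qed
  then show ?case by blast
qed

lemma K_deriv_has_derivative:
  assumes "x > 0"
  shows "(K_deriv j has_real_derivative K_deriv (Suc j) x) (at x)"
proof -
  obtain P c where P: "\<And>x. x > 0 \<Longrightarrow> K_deriv j x = (exp x * poly P x + c) / x ^ Suc j"
    using K_deriv_closed_form by blast
  have "(\<lambda>x. (exp x * poly P x + c) / x ^ Suc j) field_differentiable at x"
    using assms by (intro derivative_intros field_differentiable_within_exp)
      (auto simp: field_differentiable_def intro: poly_DERIV)
  then obtain D where "((\<lambda>x. (exp x * poly P x + c) / x ^ Suc j) has_real_derivative D) (at x)"
    by (auto simp: field_differentiable_def)
  then have "(K_deriv j has_real_derivative D) (at x)"
    by (rule has_field_derivative_transform_within_open[where S = "{0<..}"]) (use assms P in auto)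
  then show ?thesis by (simp add: DERIV_imp_deriv)
qed

text \<open>Lagrange's form of the remainder and continuity of the \<open>p\<close>-th derivative.\<close>

lemma K_curve_taylor_remainder:
  assumes "\<beta>\<^sub>0 > 0" and "p > 0"
  shows "((\<lambda>h. (K_curve (\<beta>\<^sub>0 + h) - (\<Sum>j<p. K_deriv j \<beta>\<^sub>0 / fact j * h ^ j)) / h ^ p)
            \<longlongrightarrow> K_deriv p \<beta>\<^sub>0 / fact p) (at 0)"
proof (rule tendstoI)
  fix e :: real assume "e > 0"
  have "isCont (K_deriv p) \<beta>\<^sub>0" using K_deriv_has_derivative[OF assms(1)] by (rule DERIV_isCont)
  then have "\<forall>\<^sub>F t in nhds \<beta>\<^sub>0. dist (K_deriv p t) (K_deriv p \<beta>\<^sub>0) < e"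
    using \<open>e > 0\<close> by (intro tendstoD) (simp add: continuous_at tendsto_at_iff_tendsto_nhds)
  then obtain d where d: "d > 0" "\<And>t. dist t \<beta>\<^sub>0 < d \<Longrightarrow> dist (K_deriv p t) (K_deriv p \<beta>\<^sub>0) < e"
    by (auto simp: eventually_nhds_metric)
  define \<delta> where "\<delta> = min d (\<beta>\<^sub>0 / 2)"
  have "\<delta> > 0" using d \<open>\<beta>\<^sub>0 > 0\<close> by (simp add: \<delta>_def)
  show "\<forall>\<^sub>F h in at 0. dist ((K_curve (\<beta>\<^sub>0 + h) - (\<Sum>j<p. K_deriv j \<beta>\<^sub>0 / fact j * h ^ j)) / h ^ p)
            (K_deriv p \<beta>\<^sub>0 / fact p) < e"
    unfolding eventually_at
  proof (intro exI conjI ballI impI)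
    fix h :: real assume "h \<noteq> 0 \<and> dist h 0 < \<delta>"
    then have h: "h \<noteq> 0" "\<bar>h\<bar> < \<delta>" by auto
    have "\<exists>t. (if \<beta>\<^sub>0 + h < \<beta>\<^sub>0 then \<beta>\<^sub>0 + h < t \<and> t < \<beta>\<^sub>0 else \<beta>\<^sub>0 < t \<and> t < \<beta>\<^sub>0 + h) \<and>
        K_curve (\<beta>\<^sub>0 + h) = (\<Sum>j<p. K_deriv j \<beta>\<^sub>0 / fact j * (\<beta>\<^sub>0 + h - \<beta>\<^sub>0) ^ j)
          + K_deriv p t / fact p * (\<beta>\<^sub>0 + h - \<beta>\<^sub>0) ^ p"
      by (rule Taylor[where a = "\<beta>\<^sub>0 / 2" and b = "2 * \<beta>\<^sub>0"])
         (use assms h K_deriv_has_derivative in \<open>auto simp: \<delta>_def abs_less_iff\<close>)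
    then obtain t where
      between: "if \<beta>\<^sub>0 + h < \<beta>\<^sub>0 then \<beta>\<^sub>0 + h < t \<and> t < \<beta>\<^sub>0 else \<beta>\<^sub>0 < t \<and> t < \<beta>\<^sub>0 + h"
      and "K_curve (\<beta>\<^sub>0 + h) = (\<Sum>j<p. K_deriv j \<beta>\<^sub>0 / fact j * (\<beta>\<^sub>0 + h - \<beta>\<^sub>0) ^ j)
          + K_deriv p t / fact p * (\<beta>\<^sub>0 + h - \<beta>\<^sub>0) ^ p" by blast
    then have K: "K_curve (\<beta>\<^sub>0 + h) = (\<Sum>j<p. K_deriv j \<beta>\<^sub>0 / fact j * h ^ j) + K_deriv p t / fact p * h ^ p"
      by (simp only: add_diff_cancel_left')
    have t: "\<bar>t - \<beta>\<^sub>0\<bar> < \<bar>h\<bar>" using between by (auto split: if_splits)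
    have "dist (K_deriv p t) (K_deriv p \<beta>\<^sub>0) < e"
      using t h by (intro d) (auto simp: dist_real_def \<delta>_def)
    moreover have "dist (K_deriv p t / fact p) (K_deriv p \<beta>\<^sub>0 / fact p) \<le> dist (K_deriv p t) (K_deriv p \<beta>\<^sub>0)"
    proof -
      have "\<bar>K_deriv p t - K_deriv p \<beta>\<^sub>0\<bar> / fact p \<le> \<bar>K_deriv p t - K_deriv p \<beta>\<^sub>0\<bar> / 1"
        by (intro divide_left_mono fact_ge_1) auto
      then show ?thesis by (simp add: dist_real_def flip: diff_divide_distrib)
    qed
    ultimately show "dist ((K_curve (\<beta>\<^sub>0 + h) - (\<Sum>j<p. K_deriv j \<beta>\<^sub>0 / fact j * h ^ j)) / h ^ p)
            (K_deriv p \<beta>\<^sub>0 / fact p) < e"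
      using K h by simp
  qed (fact \<open>\<delta> > 0\<close>)
qed

text \<open>With \<open>h = b / n\<^sup>\<alpha>\<close>, the sequence \<open>K n\<close> is the Taylor polynomial of \<open>K_curve\<close> with the coefficient of \<open>h\<^sup>p\<close>
replaced by \<open>l / p!\<close>. Hence \<open>K_curve (\<beta> n) - K n\<close> is asymptotically the discrepancy in that coefficient times
\<open>h\<^sup>p\<close>.\<close>

lemma parameter_sequence_limits:
  fixes \<beta>\<^sub>0 b \<alpha> l :: real and p :: nat and \<beta> K :: "nat \<Rightarrow> real"
  assumes "\<beta>\<^sub>0 > 0" and "b \<noteq> 0" and "p > 0" and "\<alpha> > 0"
  defines "\<beta> \<equiv> beta_seq \<beta>\<^sub>0 b \<alpha>" and "K \<equiv> K_seq \<beta>\<^sub>0 b p l \<alpha>"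
  shows "\<beta> \<longlonglongrightarrow> \<beta>\<^sub>0" and "K \<longlonglongrightarrow> K_curve \<beta>\<^sub>0"
    and "(\<lambda>n. real n powr (real p * \<alpha>) * quad_coeff (\<beta> n) (K n))
           \<longlonglongrightarrow> 1 / fact p * \<beta>\<^sub>0 * (K_deriv p \<beta>\<^sub>0 - l) * b ^ p"
proof -
  define h where "h n = b / real n powr \<alpha>" for n
  have "((\<lambda>x. b / x powr \<alpha>) \<longlongrightarrow> 0) at_top" using \<open>\<alpha> > 0\<close> by real_asymp
  then have h0: "h \<longlonglongrightarrow> 0" unfolding h_def[abs_def]
    using filterlim_real_sequentially by (rule filterlim_compose)
  then have h: "filterlim h (at 0) sequentially"
    using eventually_gt_at_top[of 0] \<open>b \<noteq> 0\<close> by (auto simp: filterlim_at h_def elim: eventually_mono)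
  have \<beta>_eq: "\<beta> n = \<beta>\<^sub>0 + h n" for n by (simp add: \<beta>_def beta_seq_def h_def)
  show \<beta>: "\<beta> \<longlonglongrightarrow> \<beta>\<^sub>0" unfolding \<beta>_eq[abs_def] using tendsto_add[OF tendsto_const h0] by simp
  have h_pow: "h n ^ j = b ^ j / real n powr (real j * \<alpha>)" if "n > 0" for n j
    using that by (simp add: h_def power_divide powr_power mult.commute)
  have K_eq: "K n = (\<Sum>j<p. K_deriv j \<beta>\<^sub>0 / fact j * h n ^ j) + l / fact p * h n ^ p" if "n > 0" for n
  proof -
    have "(\<Sum>j<p. K_deriv j \<beta>\<^sub>0 / fact j * h n ^ j) = K_curve \<beta>\<^sub>0 + (\<Sum>j=1..p-1. K_deriv j \<beta>\<^sub>0 / fact j * h n ^ j)"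
    proof -
      have "{..<p} = insert 0 {1..p-1}" using \<open>p > 0\<close> by auto
      then show ?thesis by simp
    qed
    then show ?thesis unfolding K_def K_seq_def by (simp add: h_pow[OF that])
  qed
  define R where "R n = (K_curve (\<beta> n) - (\<Sum>j<p. K_deriv j \<beta>\<^sub>0 / fact j * h n ^ j)) / h n ^ p" for n
  have R: "R \<longlonglongrightarrow> K_deriv p \<beta>\<^sub>0 / fact p"
    unfolding R_def[abs_def] \<beta>_eq using h
    by (rule filterlim_compose[OF K_curve_taylor_remainder[OF \<open>\<beta>\<^sub>0 > 0\<close> \<open>p > 0\<close>]])
  have diff: "K_curve (\<beta> n) - K n = h n ^ p * (R n - l / fact p)" if "n > 0" for n
  proof -
    have nz: "h n ^ p \<noteq> 0" using that \<open>b \<noteq> 0\<close> by (simp add: h_def)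
    define S where "S = (\<Sum>j<p. K_deriv j \<beta>\<^sub>0 / fact j * h n ^ j)"
    have K: "K n = S + l / fact p * h n ^ p" unfolding S_def by (rule K_eq[OF that])
    have "h n ^ p * R n = K_curve (\<beta> n) - S"
      unfolding R_def S_def[symmetric] times_divide_eq_right by (rule nonzero_mult_div_cancel_left[OF nz])
    then show ?thesis unfolding K by (simp add: right_diff_distrib)
  qed
  have "isCont (K_deriv 0) \<beta>\<^sub>0" by (rule DERIV_isCont[OF K_deriv_has_derivative[OF \<open>\<beta>\<^sub>0 > 0\<close>]])
  then have "isCont K_curve \<beta>\<^sub>0" by simp
  then have K\<beta>: "(\<lambda>n. K_curve (\<beta> n)) \<longlonglongrightarrow> K_curve \<beta>\<^sub>0" using \<beta> by (rule isCont_tendsto_compose)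
  have "(\<lambda>n. K_curve (\<beta> n) - h n ^ p * (R n - l / fact p)) \<longlonglongrightarrow> K_curve \<beta>\<^sub>0 - 0 ^ p * (K_deriv p \<beta>\<^sub>0 / fact p - l / fact p)"
    by (intro tendsto_diff tendsto_mult tendsto_power tendsto_const K\<beta> h0 R)
  then have "(\<lambda>n. K_curve (\<beta> n) - h n ^ p * (R n - l / fact p)) \<longlonglongrightarrow> K_curve \<beta>\<^sub>0"
    using \<open>p > 0\<close> by (simp add: power_0_left)
  then show K: "K \<longlonglongrightarrow> K_curve \<beta>\<^sub>0"
  proof (rule Lim_transform_eventually)
    show "\<forall>\<^sub>F n in sequentially. K_curve (\<beta> n) - h n ^ p * (R n - l / fact p) = K n"
      using eventually_gt_at_top[of 0]
    proof eventually_elim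
      case (elim n)
      show ?case unfolding diff[OF elim, symmetric] by simp
    qed
  qed
  have "K_curve \<beta>\<^sub>0 > 0" using \<open>\<beta>\<^sub>0 > 0\<close> by (simp add: K_curve_def add_pos_pos)
  then have "(\<lambda>n. \<beta> n * K n / K_curve (\<beta> n) * (b ^ p * (R n - l / fact p)))
      \<longlonglongrightarrow> \<beta>\<^sub>0 * K_curve \<beta>\<^sub>0 / K_curve \<beta>\<^sub>0 * (b ^ p * (K_deriv p \<beta>\<^sub>0 / fact p - l / fact p))"
    by (intro tendsto_diff tendsto_mult tendsto_divide tendsto_const K\<beta> K \<beta> R) simp
  also have "\<beta>\<^sub>0 * K_curve \<beta>\<^sub>0 / K_curve \<beta>\<^sub>0 * (b ^ p * (K_deriv p \<beta>\<^sub>0 / fact p - l / fact p))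
      = 1 / fact p * \<beta>\<^sub>0 * (K_deriv p \<beta>\<^sub>0 - l) * b ^ p"
    using \<open>K_curve \<beta>\<^sub>0 > 0\<close> by (simp add: field_simps)
  finally show "(\<lambda>n. real n powr (real p * \<alpha>) * quad_coeff (\<beta> n) (K n))
           \<longlonglongrightarrow> 1 / fact p * \<beta>\<^sub>0 * (K_deriv p \<beta>\<^sub>0 - l) * b ^ p"
  proof (rule Lim_transform_eventually)
    show "\<forall>\<^sub>F n in sequentially. \<beta> n * K n / K_curve (\<beta> n) * (b ^ p * (R n - l / fact p))
        = real n powr (real p * \<alpha>) * quad_coeff (\<beta> n) (K n)"
      using eventually_gt_at_top[of 0]
    proof eventually_elim
      case (elim n)
      then show ?case unfolding quad_coeff_def diff[OF elim] h_pow[OF elim] by simp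
    qed
  qed
qed

section \<open>The rescaled free-energy functional\<close>

text \<open>\<open>G\<close> on the scale \<open>x = y / n\<^sup>\<gamma>\<close>, as a function of \<open>s = y\<^sup>2\<close>; the prefactor makes the quartic coefficient of
order one.\<close>

definition rescaled_G :: "real \<Rightarrow> real \<Rightarrow> real \<Rightarrow> nat \<Rightarrow> real \<Rightarrow> real" where
  "rescaled_G \<beta> K \<gamma> n s = real n powr (4 * \<gamma>) * G_fun \<beta> K (real n powr (- \<gamma>) * sqrt s)"

lemma rescaled_G_0: "rescaled_G \<beta> K \<gamma> n 0 = 0"
  by (simp add: rescaled_G_def G_fun_0)

lemma continuous_on_rescaled_G: "continuous_on A (rescaled_G \<beta> K \<gamma> n)"
  unfolding rescaled_G_def[abs_def]
  by (intro continuous_intros continuous_on_compose2[OF continuous_on_G_fun[of UNIV]]) auto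

text \<open>In this form the rescaling acts linearly on \<open>s\<close>, as strict convexity requires.\<close>

lemma rescaled_G_eq: "rescaled_G \<beta> K \<gamma> n s = real n powr (4 * \<gamma>) * G_fun \<beta> K (sqrt ((real n powr (- \<gamma>))\<^sup>2 * s))"
  by (simp add: rescaled_G_def real_sqrt_mult)

lemma rescaled_G_strictly_convex:
  assumes "exp \<beta> < 4" "\<beta> > 0" "K > 0" "n > 0"
  shows "strictly_convex_nonneg (rescaled_G \<beta> K \<gamma> n)"
  unfolding rescaled_G_eq[abs_def] using assms
  by (intro strictly_convex_nonneg_rescale[OF G_fun_strictly_convex_in_square]) auto

lemma rescaled_G_minimizer:
  assumes "exp \<beta> < 4" "\<beta> > 0" "K > 0" "n > 0"
    and "s > 0" and min: "\<And>t. t \<ge> 0 \<Longrightarrow> rescaled_G \<beta> K \<gamma> n s \<le> rescaled_G \<beta> K \<gamma> n t"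
  shows "(\<beta>, K) \<in> coexistence_region"
    and "\<exists>!x. x > 0 \<and> x \<in> global_min_points (G_fun \<beta> K)"
    and "magnetization \<beta> K = real n powr (- \<gamma>) * sqrt s"
proof -
  define r where "r = real n powr (- \<gamma>)"
  have "r > 0" using \<open>n > 0\<close> by (simp add: r_def)
  have "G_fun \<beta> K (sqrt (r\<^sup>2 * s)) \<le> G_fun \<beta> K (sqrt t)" if "t \<ge> 0" for t
    using min[of "t / r\<^sup>2"] that \<open>r > 0\<close> \<open>n > 0\<close> unfolding rescaled_G_eq r_def[symmetric] by simp
  note minpt = even_function_pos_min_point[of "G_fun \<beta> K", OF G_fun_uminus G_fun_strictly_convex_in_square[OF assms(1-3)] _ this]
  have pos: "r\<^sup>2 * s > 0" using \<open>r > 0\<close> \<open>s > 0\<close> by simp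
  show "(\<beta>, K) \<in> coexistence_region"
    unfolding coexistence_region_def mem_Collect_eq case_prod_conv
    using minpt(1)[OF pos, of "sqrt (r\<^sup>2 * s)"] minpt(1)[OF pos, of "- sqrt (r\<^sup>2 * s)"] pos assms
    by (intro conjI bexI[of _ "sqrt (r\<^sup>2 * s)"] bexI[of _ "- sqrt (r\<^sup>2 * s)"]) auto
  show "\<exists>!x. x > 0 \<and> x \<in> global_min_points (G_fun \<beta> K)"
    by (rule minpt(2)[OF pos])
  show "magnetization \<beta> K = real n powr (- \<gamma>) * sqrt s"
    using minpt(3)[OF pos] \<open>r > 0\<close> by (simp add: magnetization_def real_sqrt_mult r_def)
qed

text \<open>The quadratic coefficient is multiplied by \<open>n\<^bsup>4\<gamma>\<^esup> n\<^bsup>-2\<gamma>\<^esup> = n\<^bsup>2\<gamma>\<^esup>\<close>, the quartic one by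
\<open>n\<^bsup>4\<gamma>\<^esup> n\<^bsup>-4\<gamma>\<^esup> = 1\<close>.\<close>

lemma rescaled_G_tendsto:
  assumes "\<beta>\<^sub>0 > 0" "\<beta> \<longlonglongrightarrow> \<beta>\<^sub>0" "K \<longlonglongrightarrow> K_curve \<beta>\<^sub>0" "\<gamma> > 0"
    and quadratic: "(\<lambda>n. real n powr (2 * \<gamma>) * quad_coeff (\<beta> n) (K n)) \<longlonglongrightarrow> A" and "s \<ge> 0"
  shows "(\<lambda>n. rescaled_G (\<beta> n) (K n) \<gamma> n s) \<longlonglongrightarrow> A * s + c4 \<beta>\<^sub>0 * s\<^sup>2"
  unfolding rescaled_G_def
proof (rule G_fun_scaling_limit[OF assms(1-3) _ _ _ _ \<open>s \<ge> 0\<close>])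
  have powers: "real n powr (4 * \<gamma>) * (real n powr (- \<gamma>)) ^ 4 = 1"
    "real n powr (4 * \<gamma>) * (real n powr (- \<gamma>))\<^sup>2 = real n powr (2 * \<gamma>)" if "n > 0" for n
    using that by (simp_all add: powr_power flip: powr_add)
  show "(\<lambda>n. real n powr (- \<gamma>)) \<longlonglongrightarrow> 0"
    using tendsto_neg_powr[OF _ filterlim_real_sequentially, of "- \<gamma>"] \<open>\<gamma> > 0\<close> by simp
  show "\<forall>\<^sub>F n in sequentially. 0 < real n powr (- \<gamma>)"
    using eventually_gt_at_top[of 0] by eventually_elim simp
  have "\<forall>\<^sub>F n in sequentially. real n powr (4 * \<gamma>) * (real n powr (- \<gamma>)) ^ 4 = 1"
    using eventually_gt_at_top[of 0] by eventually_elim (rule powers(1))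
  then show "(\<lambda>n. real n powr (4 * \<gamma>) * (real n powr (- \<gamma>)) ^ 4) \<longlonglongrightarrow> 1"
    by (rule tendsto_eventually)
  have "\<forall>\<^sub>F n in sequentially. real n powr (2 * \<gamma>) * quad_coeff (\<beta> n) (K n)
      = real n powr (4 * \<gamma>) * (real n powr (- \<gamma>))\<^sup>2 * quad_coeff (\<beta> n) (K n)"
    using eventually_gt_at_top[of 0] by eventually_elim (simp only: powers(2))
  with quadratic show "(\<lambda>n. real n powr (4 * \<gamma>) * (real n powr (- \<gamma>))\<^sup>2 * quad_coeff (\<beta> n) (K n)) \<longlonglongrightarrow> A"
    by (rule Lim_transform_eventually)
qed

text \<open>On the scale \<open>n\<^bsup>-\<gamma>\<^esup>\<close> the error of order \<open>n\<^bsup>-1/2\<^esup>\<close> from the Gaussian smoothing disappears if \<open>\<gamma> < 1/2\<close>. The factor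
\<open>n\<^bsup>1-4\<gamma>\<^esup>\<close> in the exponent distinguishes the regimes: it equals \<open>1\<close> for \<open>\<gamma> = 1/4\<close> and diverges for
\<open>\<gamma> < 1/4\<close>.\<close>

lemma expected_abs_spin_rescaled:
  assumes "\<beta>\<^sub>0 > 0" "\<beta> \<longlonglongrightarrow> \<beta>\<^sub>0" "K \<longlonglongrightarrow> K\<^sub>0" "K\<^sub>0 > 0" "\<gamma> < 1 / 2"
  shows "(\<lambda>n. expected_abs_spin n (\<beta> n) (K n) * real n powr \<gamma>
      - gibbs_abs_mean (\<lambda>y. real n powr (1 - 4 * \<gamma>) * rescaled_G (\<beta> n) (K n) \<gamma> n (y\<^sup>2))) \<longlonglongrightarrow> 0"
proof (rule Lim_null_comparison)
  have "\<forall>\<^sub>F n in sequentially. \<beta> n > 0" "\<forall>\<^sub>F n in sequentially. K n > 0"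
    using assms by (auto intro: order_tendstoD)
  then show "\<forall>\<^sub>F n in sequentially. norm (expected_abs_spin n (\<beta> n) (K n) * real n powr \<gamma>
      - gibbs_abs_mean (\<lambda>y. real n powr (1 - 4 * \<gamma>) * rescaled_G (\<beta> n) (K n) \<gamma> n (y\<^sup>2)))
      \<le> 1 / sqrt (2 * \<beta> n * K n) * real n powr (\<gamma> - 1 / 2)"
    using eventually_gt_at_top[of 0]
  proof eventually_elim
    case (elim n)
    let ?E = "expected_abs_spin n (\<beta> n) (K n)"
    let ?M = "gibbs_abs_mean (\<lambda>y. real n powr (1 - 4 * \<gamma>) * rescaled_G (\<beta> n) (K n) \<gamma> n (y\<^sup>2))"
    define r where "r = real n powr (- \<gamma>)"
    have "r > 0" using elim by (simp add: r_def)
    have "real n powr (1 - 4 * \<gamma>) * rescaled_G (\<beta> n) (K n) \<gamma> n (y\<^sup>2) = real n * G_fun (\<beta> n) (K n) (r * y)" for y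
    proof -
      have "G_fun (\<beta> n) (K n) (r * sqrt (y\<^sup>2)) = G_fun (\<beta> n) (K n) (r * y)"
        by (cases "y \<ge> 0") (auto simp: G_fun_uminus)
      moreover have "real n powr (1 - 4 * \<gamma>) * real n powr (4 * \<gamma>) = real n"
        using elim by (simp flip: powr_add)
      ultimately show ?thesis unfolding rescaled_G_def r_def by (simp flip: mult.assoc)
    qed
    then have "gibbs_abs_mean (\<lambda>x. real n * G_fun (\<beta> n) (K n) x) = r * ?M"
      using gibbs_abs_mean_scale[OF \<open>r > 0\<close>, of "\<lambda>x. real n * G_fun (\<beta> n) (K n) x"] by simp
    then have "\<bar>?E - r * ?M\<bar> \<le> 1 / sqrt (2 * real n * \<beta> n * K n)"
      using expected_abs_spin_close_to_gibbs_mean[of n "\<beta> n" "K n"] elim by simp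
    then have "\<bar>?E - r * ?M\<bar> * real n powr \<gamma> \<le> 1 / sqrt (2 * real n * \<beta> n * K n) * real n powr \<gamma>"
      by (rule mult_right_mono) simp
    moreover have "\<bar>?E - r * ?M\<bar> * real n powr \<gamma> = \<bar>?E * real n powr \<gamma> - ?M\<bar>"
    proof -
      have "r * real n powr \<gamma> = 1" using elim by (simp add: r_def flip: powr_add)
      moreover have "(?E - r * ?M) * real n powr \<gamma> = ?E * real n powr \<gamma> - (r * real n powr \<gamma>) * ?M"
        unfolding left_diff_distrib by (simp only: mult_ac)
      ultimately have "(?E - r * ?M) * real n powr \<gamma> = ?E * real n powr \<gamma> - ?M" by simp
      then show ?thesis by (metis abs_mult abs_of_nonneg powr_ge_zero)
    qed
    moreover have "1 / sqrt (2 * real n * \<beta> n * K n) * real n powr \<gamma> = 1 / sqrt (2 * \<beta> n * K n) * real n powr (\<gamma> - 1 / 2)"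
      using elim by (simp add: real_sqrt_mult powr_diff powr_half_sqrt)
    ultimately show ?case by simp
  qed
  have "(\<lambda>n. real n powr (\<gamma> - 1 / 2)) \<longlonglongrightarrow> 0"
    using \<open>\<gamma> < 1 / 2\<close> by (intro tendsto_neg_powr filterlim_real_sequentially) auto
  moreover have "(\<lambda>n. 1 / sqrt (2 * \<beta> n * K n)) \<longlonglongrightarrow> 1 / sqrt (2 * \<beta>\<^sub>0 * K\<^sub>0)"
    using assms by (intro tendsto_intros) auto
  ultimately show "(\<lambda>n. 1 / sqrt (2 * \<beta> n * K n) * real n powr (\<gamma> - 1 / 2)) \<longlonglongrightarrow> 0"
    using tendsto_mult by fastforce
qed

lemma quadratic_strictly_convex:
  fixes A B :: real
  assumes "B > 0"
  shows "strictly_convex_nonneg (\<lambda>s. A * s + B * s\<^sup>2)"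
  unfolding strictly_convex_nonneg_def
proof (intro allI impI, elim conjE)
  fix x y z :: real assume "0 \<le> x" "x < y" "y < z"
  then have "B * ((z - y) * (y - x) * (z - x)) > 0" using assms by simp
  also have "B * ((z - y) * (y - x) * (z - x))
      = (z - y) * (A * x + B * x\<^sup>2) + (y - x) * (A * z + B * z\<^sup>2) - (z - x) * (A * y + B * y\<^sup>2)"
    by (simp add: algebra_simps power2_eq_square)
  finally show "(z - x) * (A * y + B * y\<^sup>2) < (z - y) * (A * x + B * x\<^sup>2) + (y - x) * (A * z + B * z\<^sup>2)"
    by simp
qed

lemma quadratic_strict_min:
  fixes A B :: real
  assumes "B > 0" and "s \<noteq> - A / (2 * B)"
  shows "A * (- A / (2 * B)) + B * (- A / (2 * B))\<^sup>2 < A * s + B * s\<^sup>2"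
proof -
  define s\<^sub>0 where "s\<^sub>0 = - A / (2 * B)"
  have A: "A = - 2 * B * s\<^sub>0" using assms by (simp add: s\<^sub>0_def)
  have "B * (s - s\<^sub>0)\<^sup>2 > 0" using assms by (simp add: s\<^sub>0_def)
  then show ?thesis unfolding s\<^sub>0_def[symmetric] A using assms(1) by (simp add: algebra_simps power2_eq_square)
qed

lemma quadratic_eventually_positive:
  fixes A B :: real
  assumes "B > 0"
  shows "\<exists>\<sigma>>0. A * \<sigma> + B * \<sigma>\<^sup>2 > (0::real)"
proof -
  define \<sigma> where "\<sigma> = \<bar>A\<bar> / B + 1"
  have "\<sigma> > 0" using assms unfolding \<sigma>_def by (intro add_nonneg_pos) auto
  have "\<bar>A\<bar> + B = B * \<sigma>" using assms by (simp add: \<sigma>_def distrib_left)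
  then have "A + B * \<sigma> > 0" using assms by linarith
  with \<open>\<sigma> > 0\<close> have "\<sigma> * (A + B * \<sigma>) > 0" by simp
  then have "A * \<sigma> + B * \<sigma>\<^sup>2 > 0" by (simp add: algebra_simps power2_eq_square)
  with \<open>\<sigma> > 0\<close> show ?thesis by blast
qed

lemma asymp_equiv_powr_of_scaled_limit:
  assumes "(\<lambda>n. f n * real n powr \<gamma>) \<longlonglongrightarrow> L" and "L \<noteq> 0"
  shows "f \<sim>[sequentially] (\<lambda>n. L / real n powr \<gamma>)"
proof (rule asymp_equivI')
  have "(\<lambda>n. f n * real n powr \<gamma> / L) \<longlonglongrightarrow> L / L" using assms by (intro tendsto_intros) auto
  then show "(\<lambda>n. f n / (L / real n powr \<gamma>)) \<longlonglongrightarrow> 1" using \<open>L \<noteq> 0\<close> by simp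
qed

theorem theorem5p2:
  fixes \<beta>\<^sub>0 b l \<alpha> :: real and p :: nat
    and \<beta> K m E :: "nat \<Rightarrow> real" and g :: "real \<Rightarrow> real" and xbar ybar zbar :: real
  assumes "0 < \<beta>\<^sub>0" and "\<beta>\<^sub>0 < beta_crit"
    and "b \<in> {1, -1}"
    and "p \<ge> 2"
    and "l \<noteq> K_deriv p \<beta>\<^sub>0"
    and "(K_deriv p \<beta>\<^sub>0 - l) * b ^ p < 0"
    and "\<alpha> > 0"
  defines "\<beta> \<equiv> beta_seq \<beta>\<^sub>0 b \<alpha>"
    and "K \<equiv> K_seq \<beta>\<^sub>0 b p l \<alpha>"
    and "m \<equiv> \<lambda>n. magnetization (\<beta> n) (K n)"
    and "E \<equiv> \<lambda>n. expected_abs_spin n (\<beta> n) (K n)"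
    and "g \<equiv> g_poly \<beta>\<^sub>0 b p l"
    and "xbar \<equiv> pos_min_point g"
    and "ybar \<equiv> gibbs_abs_mean (g_tilde \<beta>\<^sub>0)"
    and "zbar \<equiv> gibbs_abs_mean g"
  shows
    "(\<exists>!x. x > 0 \<and> x \<in> global_min_points g) \<and>
     (\<forall>\<^sub>F n in sequentially. \<beta> n > 0 \<and> K n > 0 \<and> (\<beta> n, K n) \<in> coexistence_region \<and>
        (\<exists>!x. x > 0 \<and> x \<in> global_min_points (G_fun (\<beta> n) (K n)))) \<and>
     (m \<sim>[sequentially] (\<lambda>n. xbar / real n powr (real p * \<alpha> / 2)) \<and>
      (\<forall>n\<ge>1. xbar / real n powr (real p * \<alpha> / 2) = xbar * \<bar>\<beta>\<^sub>0 - \<beta> n\<bar> powr (real p / 2))) \<and>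
     (\<alpha> < 1 / (2 * real p) \<longrightarrow>
        E \<sim>[sequentially] (\<lambda>n. xbar / real n powr (real p * \<alpha> / 2)) \<and>
        (\<lambda>n. xbar / real n powr (real p * \<alpha> / 2)) \<sim>[sequentially] m) \<and>
     (\<alpha> > 1 / (2 * real p) \<longrightarrow>
        E \<sim>[sequentially] (\<lambda>n. ybar / real n powr (1 / 4)) \<and>
        filterlim (\<lambda>n. (ybar / real n powr (1 / 4)) / m n) at_top sequentially) \<and>
     (\<alpha> = 1 / (2 * real p) \<longrightarrow>
        E \<sim>[sequentially] (\<lambda>n. zbar / real n powr (1 / 4)) \<and>
        (\<lambda>n. zbar / real n powr (1 / 4)) \<sim>[sequentially] (\<lambda>n. zbar * m n / xbar))"
proof -
  define A where "A = 1 / fact p * \<beta>\<^sub>0 * (K_deriv p \<beta>\<^sub>0 - l) * b ^ p"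
  define B where "B = c4 \<beta>\<^sub>0"
  define \<gamma> where "\<gamma> = real p * \<alpha> / 2"
  define s\<^sub>0 where "s\<^sub>0 = - A / (2 * B)"
  have "p > 0" "b \<noteq> 0" using assms(3,4) by auto
  have \<gamma>: "\<gamma> > 0" "2 * \<gamma> = real p * \<alpha>" using \<open>p > 0\<close> \<open>\<alpha> > 0\<close> by (auto simp: \<gamma>_def)
  have threshold: "\<alpha> < 1 / (2 * real p) \<longleftrightarrow> \<gamma> < 1 / 4" "\<alpha> > 1 / (2 * real p) \<longleftrightarrow> \<gamma> > 1 / 4"
    "\<alpha> = 1 / (2 * real p) \<longleftrightarrow> \<gamma> = 1 / 4"
    using \<open>p > 0\<close> by (auto simp: \<gamma>_def field_simps)
  have exp4: "exp \<beta>\<^sub>0 < 4" using \<open>\<beta>\<^sub>0 < beta_crit\<close> unfolding beta_crit_def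
    by (metis exp_less_mono exp_ln zero_less_numeral)
  then have "B > 0" unfolding B_def c4_def by (intro divide_pos_pos mult_pos_pos zero_less_power add_pos_pos) auto
  have "A = (\<beta>\<^sub>0 / fact p) * ((K_deriv p \<beta>\<^sub>0 - l) * b ^ p)" by (simp add: A_def)
  also have "\<dots> < 0" by (rule mult_pos_neg[OF _ assms(6)]) (use assms(1) in simp)
  finally have "A < 0" .
  then have "s\<^sub>0 > 0" using \<open>B > 0\<close> by (simp add: s\<^sub>0_def field_simps)
  have min\<^sub>0: "A * s\<^sub>0 + B * s\<^sub>0\<^sup>2 < A * s + B * s\<^sup>2" if "s \<noteq> s\<^sub>0" for s
    using that unfolding s\<^sub>0_def by (rule quadratic_strict_min[OF \<open>B > 0\<close>])

  have g: "g x = A * x\<^sup>2 + B * (x\<^sup>2)\<^sup>2" for x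
    by (simp add: g_def g_poly_def A_def B_def)
  have g_conv: "strictly_convex_nonneg (\<lambda>s. g (sqrt s))"
    using quadratic_strictly_convex[OF \<open>B > 0\<close>, of A]
    unfolding strictly_convex_nonneg_def g by simp
  have g_min: "g (sqrt s\<^sub>0) \<le> g (sqrt t)" if "t \<ge> 0" for t
    using min\<^sub>0[of t] that \<open>s\<^sub>0 > 0\<close> unfolding g by (cases "t = s\<^sub>0") auto
  have g_even: "g (- x) = g x" for x unfolding g by simp
  note g_pt = even_function_pos_min_point[of g, OF g_even g_conv \<open>s\<^sub>0 > 0\<close> g_min]
  have xbar: "xbar = sqrt s\<^sub>0" "xbar > 0" using g_pt(3) \<open>s\<^sub>0 > 0\<close> by (auto simp: xbar_def)

  note limits = parameter_sequence_limits[OF \<open>\<beta>\<^sub>0 > 0\<close> \<open>b \<noteq> 0\<close> \<open>p > 0\<close> \<open>\<alpha> > 0\<close>]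
  note lims = limits(1)[folded \<beta>_def] limits(2,3)[of l, folded \<beta>_def K_def A_def]
  have "K_curve \<beta>\<^sub>0 > 0" using \<open>\<beta>\<^sub>0 > 0\<close> by (simp add: K_curve_def add_pos_pos)
  have "(\<lambda>n. exp (\<beta> n)) \<longlonglongrightarrow> exp \<beta>\<^sub>0" by (intro tendsto_exp lims)
  then have "\<forall>\<^sub>F n in sequentially. exp (\<beta> n) < 4" using exp4 by (rule order_tendstoD)
  moreover have "\<forall>\<^sub>F n in sequentially. \<beta> n > 0" using lims(1) \<open>\<beta>\<^sub>0 > 0\<close> by (rule order_tendstoD)
  moreover have "\<forall>\<^sub>F n in sequentially. K n > 0" using lims(2) \<open>K_curve \<beta>\<^sub>0 > 0\<close> by (rule order_tendstoD)
  ultimately have "\<forall>\<^sub>F n in sequentially. exp (\<beta> n) < 4 \<and> \<beta> n > 0 \<and> K n > 0 \<and> n > 0"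
    using eventually_gt_at_top[of 0] by eventually_elim simp
  then obtain N where N: "\<And>n. n \<ge> N \<Longrightarrow> exp (\<beta> n) < 4 \<and> \<beta> n > 0 \<and> K n > 0 \<and> n > 0"
    by (auto simp: eventually_sequentially)
  define \<Phi> where "\<Phi> c n = rescaled_G (\<beta> n) (K n) c n" for c n
  have conv: "strictly_convex_nonneg (\<Phi> c n)" if "n \<ge> N" for c n
    unfolding \<Phi>_def using N[OF that] by (intro rescaled_G_strictly_convex) auto
  have cont: "continuous_on {0..} (\<Phi> c n)" for c n
    unfolding \<Phi>_def by (rule continuous_on_rescaled_G)
  have zero: "\<Phi> c n 0 = 0" for c n by (simp add: \<Phi>_def rescaled_G_0)

  \<comment> \<open>The magnetization lives on the scale \<open>n\<^bsup>-\<gamma>\<^esup>\<close> for every \<open>\<alpha>\<close>, since it is the minimizer of \<open>G\<close> alone.\<close>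
  have quad: "(\<lambda>n. real n powr (2 * \<gamma>) * quad_coeff (\<beta> n) (K n)) \<longlonglongrightarrow> A" using lims(3) by (simp only: \<gamma>(2))
  have lim: "(\<lambda>n. \<Phi> \<gamma> n s) \<longlonglongrightarrow> A * s + B * s\<^sup>2" if "s \<ge> 0" for s
    unfolding \<Phi>_def B_def by (rule rescaled_G_tendsto[OF \<open>\<beta>\<^sub>0 > 0\<close> lims(1,2) \<gamma>(1) quad that])
  obtain s where s: "s \<longlonglongrightarrow> s\<^sub>0" "\<forall>\<^sub>F n in sequentially. s n > 0 \<and> (\<forall>t\<ge>0. \<Phi> \<gamma> n (s n) \<le> \<Phi> \<gamma> n t)"
    by (rule convergent_convex_minimizer[where \<Phi> = "\<Phi> \<gamma>" and N = N and s\<^sub>0 = s\<^sub>0 and \<Psi> = "\<lambda>s. A * s + B * s\<^sup>2"])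
       (use conv cont lim \<open>s\<^sub>0 > 0\<close> min\<^sub>0 in auto)
  have m_ev: "\<forall>\<^sub>F n in sequentially. \<beta> n > 0 \<and> K n > 0 \<and> (\<beta> n, K n) \<in> coexistence_region \<and>
        (\<exists>!x. x > 0 \<and> x \<in> global_min_points (G_fun (\<beta> n) (K n))) \<and> m n > 0 \<and>
        m n * real n powr \<gamma> = sqrt (s n)"
    using s(2) eventually_ge_at_top[of N]
  proof eventually_elim
    case (elim n)
    have "rescaled_G (\<beta> n) (K n) \<gamma> n (s n) \<le> rescaled_G (\<beta> n) (K n) \<gamma> n t" if "t \<ge> 0" for t
      using elim that by (auto simp: \<Phi>_def)
    note minimizer = rescaled_G_minimizer[where s = "s n", OF _ _ _ _ _ this]
    have "m n = real n powr (- \<gamma>) * sqrt (s n)"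
      unfolding m_def using N[OF elim(2)] elim(1) by (intro minimizer(3)) auto
    moreover have "real n powr (- \<gamma>) * real n powr \<gamma> = 1" using N[OF elim(2)] by (simp flip: powr_add)
    then have "real n powr (- \<gamma>) * sqrt (s n) * real n powr \<gamma> = sqrt (s n)"
      by (metis mult.commute mult.left_commute mult_1)
    ultimately show ?case using N[OF elim(2)] elim(1) minimizer(1,2) by simp
  qed
  have "(\<lambda>n. sqrt (s n)) \<longlonglongrightarrow> xbar" unfolding xbar(1) by (intro tendsto_intros s)
  then have m_lim: "(\<lambda>n. m n * real n powr \<gamma>) \<longlonglongrightarrow> xbar"
    by (rule Lim_transform_eventually) (use m_ev in eventually_elim, simp)
  have m_equiv: "m \<sim>[sequentially] (\<lambda>n. xbar / real n powr \<gamma>)"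
    using m_lim xbar(2) by (intro asymp_equiv_powr_of_scaled_limit) auto
  have dist: "xbar / real n powr \<gamma> = xbar * \<bar>\<beta>\<^sub>0 - \<beta> n\<bar> powr (real p / 2)" if "n \<ge> 1" for n
  proof -
    have "\<bar>\<beta>\<^sub>0 - \<beta> n\<bar> = real n powr (- \<alpha>)" using assms(3) by (auto simp: \<beta>_def beta_seq_def powr_minus_divide)
    then have "\<bar>\<beta>\<^sub>0 - \<beta> n\<bar> powr (real p / 2) = real n powr (- \<gamma>)" by (simp add: powr_powr \<gamma>_def mult.commute)
    then show ?thesis by (simp add: powr_minus_divide)
  qed

  have E_lim: "(\<lambda>n. E n * real n powr c) \<longlonglongrightarrow> L"
    if "c < 1 / 2" and "(\<lambda>n. gibbs_abs_mean (\<lambda>y. real n powr (1 - 4 * c) * \<Phi> c n (y\<^sup>2))) \<longlonglongrightarrow> L" for c L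
    using tendsto_add[OF expected_abs_spin_rescaled[OF \<open>\<beta>\<^sub>0 > 0\<close> lims(1,2) \<open>K_curve \<beta>\<^sub>0 > 0\<close> that(1)] that(2)[unfolded \<Phi>_def]]
    by (simp add: E_def)
  \<comment> \<open>On the critical scale \<open>n\<^bsup>-1/4\<^esup>\<close> the fluctuations have order one; \<open>C\<close> is \<open>0\<close> above the threshold and
     \<open>A\<close> at the threshold.\<close>
  have quarter: "E \<sim>[sequentially] (\<lambda>n. gibbs_abs_mean (\<lambda>y. C * y\<^sup>2 + B * (y\<^sup>2)\<^sup>2) / real n powr (1 / 4)) \<and>
      gibbs_abs_mean (\<lambda>y. C * y\<^sup>2 + B * (y\<^sup>2)\<^sup>2) > 0"
    if "(\<lambda>n. real n powr (2 * (1 / 4)) * quad_coeff (\<beta> n) (K n)) \<longlonglongrightarrow> C" for C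
  proof -
    have lim: "(\<lambda>n. \<Phi> (1 / 4) n s) \<longlonglongrightarrow> C * s + B * s\<^sup>2" if "s \<ge> 0" for s
      unfolding \<Phi>_def B_def
      by (rule rescaled_G_tendsto[OF \<open>\<beta>\<^sub>0 > 0\<close> lims(1,2) _ \<open>_ \<longlonglongrightarrow> C\<close> that]) simp
    obtain \<sigma> where \<sigma>: "\<sigma> > 0" "C * \<sigma> + B * \<sigma>\<^sup>2 > 0" using quadratic_eventually_positive[OF \<open>B > 0\<close>] by blast
    have mean: "gibbs_abs_mean (\<lambda>y. real n powr (1 - 4 * (1 / 4)) * \<Phi> (1 / 4) n (y\<^sup>2)) = gibbs_abs_mean (\<lambda>y. \<Phi> (1 / 4) n (y\<^sup>2))"
      if "n \<ge> N" for n using N[OF that] by simp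
    note gibbs = gibbs_abs_mean_tendsto[where N = N and \<Phi> = "\<Phi> (1 / 4)" and \<Psi> = "\<lambda>s. C * s + B * s\<^sup>2",
        OF conv cont zero lim \<sigma> mean]
    have "(\<lambda>n. E n * real n powr (1 / 4)) \<longlonglongrightarrow> gibbs_abs_mean (\<lambda>y. C * y\<^sup>2 + B * (y\<^sup>2)\<^sup>2)"
      by (rule E_lim[OF _ gibbs(1)]) auto
    then show ?thesis using gibbs(2) by (intro conjI asymp_equiv_powr_of_scaled_limit) auto
  qed
  have ybar: "ybar = gibbs_abs_mean (\<lambda>y. 0 * y\<^sup>2 + B * (y\<^sup>2)\<^sup>2)"
    unfolding ybar_def g_tilde_def[abs_def] B_def by simp
  have zbar: "zbar = gibbs_abs_mean (\<lambda>y. A * y\<^sup>2 + B * (y\<^sup>2)\<^sup>2)"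
    unfolding zbar_def g[abs_def] ..

  \<comment> \<open>Below the threshold the scale of the minimizer dominates the fluctuations.\<close>
  have below_threshold: "E \<sim>[sequentially] (\<lambda>n. xbar / real n powr \<gamma>)" if "\<gamma> < 1 / 4"
  proof -
    obtain \<sigma> where \<sigma>: "\<sigma> > 0" "A * \<sigma> + B * \<sigma>\<^sup>2 > 0" using quadratic_eventually_positive[OF \<open>B > 0\<close>] by blast
    have "filterlim (\<lambda>x. x powr (1 - 4 * \<gamma>)) at_top at_top" using that by real_asymp
    then have a: "filterlim (\<lambda>n. real n powr (1 - 4 * \<gamma>)) at_top sequentially"
      using filterlim_real_sequentially by (rule filterlim_compose)
    have "(\<lambda>n. gibbs_abs_mean (\<lambda>y. real n powr (1 - 4 * \<gamma>) * \<Phi> \<gamma> n (y\<^sup>2))) \<longlonglongrightarrow> sqrt s\<^sub>0"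
      by (rule gibbs_abs_mean_laplace[where N = N and \<Psi> = "\<lambda>s. A * s + B * s\<^sup>2" and \<Phi> = "\<Phi> \<gamma>",
            OF conv cont zero lim \<sigma> \<open>s\<^sub>0 > 0\<close> min\<^sub>0 _ a refl]) (auto intro!: continuous_intros)
    then have "(\<lambda>n. E n * real n powr \<gamma>) \<longlonglongrightarrow> xbar"
      unfolding xbar(1) using that by (intro E_lim) auto
    then show ?thesis using xbar(2) by (intro asymp_equiv_powr_of_scaled_limit) auto
  qed
  have above_threshold: "E \<sim>[sequentially] (\<lambda>n. ybar / real n powr (1 / 4)) \<and>
      filterlim (\<lambda>n. (ybar / real n powr (1 / 4)) / m n) at_top sequentially" if "\<gamma> > 1 / 4"
  proof -
    \<comment> \<open>The quadratic coefficient has order \<open>n\<^bsup>-2\<gamma>\<^esup>\<close>, which is too small to be seen on the scale \<open>n\<^bsup>-1/4\<^esup>\<close>.\<close>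
    have "((\<lambda>x. x powr (1 / 2 - 2 * \<gamma>)) \<longlongrightarrow> 0) at_top" using that by real_asymp
    then have "(\<lambda>n. real n powr (1 / 2 - 2 * \<gamma>)) \<longlonglongrightarrow> 0"
      using filterlim_real_sequentially by (rule filterlim_compose)
    from tendsto_mult[OF this quad]
    have "(\<lambda>n. real n powr (1 / 2 - 2 * \<gamma>) * (real n powr (2 * \<gamma>) * quad_coeff (\<beta> n) (K n))) \<longlonglongrightarrow> 0" by simp
    moreover have "real n powr (1 / 2 - 2 * \<gamma>) * (real n powr (2 * \<gamma>) * quad_coeff (\<beta> n) (K n))
        = real n powr (2 * (1 / 4)) * quad_coeff (\<beta> n) (K n)" for n
      by (simp flip: powr_add mult.assoc)
    ultimately have "(\<lambda>n. real n powr (2 * (1 / 4)) * quad_coeff (\<beta> n) (K n)) \<longlonglongrightarrow> 0" by simp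
    from quarter[OF this] have y: "E \<sim>[sequentially] (\<lambda>n. ybar / real n powr (1 / 4))" "ybar > 0"
      unfolding ybar[symmetric] by auto
    have "filterlim (\<lambda>x. x powr (\<gamma> - 1 / 4)) at_top at_top" using that by real_asymp
    then have grow: "filterlim (\<lambda>n. real n powr (\<gamma> - 1 / 4)) at_top sequentially"
      using filterlim_real_sequentially by (rule filterlim_compose)
    have "(\<lambda>n. ybar / (m n * real n powr \<gamma>)) \<longlonglongrightarrow> ybar / xbar"
      using xbar(2) by (intro tendsto_intros m_lim) auto
    from filterlim_tendsto_pos_mult_at_top[OF this _ grow]
    have ratio: "filterlim (\<lambda>n. ybar / (m n * real n powr \<gamma>) * real n powr (\<gamma> - 1 / 4)) at_top sequentially"
      using xbar(2) y(2) by simp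
    have "\<forall>\<^sub>F n in sequentially. ybar / (m n * real n powr \<gamma>) * real n powr (\<gamma> - 1 / 4)
        = (ybar / real n powr (1 / 4)) / m n"
      using eventually_gt_at_top[of 0] by eventually_elim (simp add: powr_diff)
    from iffD1[OF filterlim_cong[OF refl refl this] ratio] show ?thesis using y(1) by blast
  qed
  have at_threshold: "E \<sim>[sequentially] (\<lambda>n. zbar / real n powr (1 / 4)) \<and>
      (\<lambda>n. zbar / real n powr (1 / 4)) \<sim>[sequentially] (\<lambda>n. zbar * m n / xbar)" if "\<gamma> = 1 / 4"
  proof
    show "E \<sim>[sequentially] (\<lambda>n. zbar / real n powr (1 / 4))"
      using quarter[of A] quad unfolding that zbar by simp
    have "(\<lambda>n. xbar / real n powr \<gamma> * (zbar / xbar)) \<sim>[sequentially] (\<lambda>n. m n * (zbar / xbar))"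
      by (intro asymp_equiv_mult asymp_equiv_symI[OF m_equiv] asymp_equiv_refl)
    then show "(\<lambda>n. zbar / real n powr (1 / 4)) \<sim>[sequentially] (\<lambda>n. zbar * m n / xbar)"
      using xbar(2) unfolding that by (simp add: mult.commute)
  qed
  have "\<forall>\<^sub>F n in sequentially. \<beta> n > 0 \<and> K n > 0 \<and> (\<beta> n, K n) \<in> coexistence_region \<and>
        (\<exists>!x. x > 0 \<and> x \<in> global_min_points (G_fun (\<beta> n) (K n)))"
    using m_ev by eventually_elim simp
  then show ?thesis
    unfolding threshold \<gamma>_def[symmetric]
    using g_pt(2) m_equiv dist below_threshold above_threshold at_threshold asymp_equiv_symI[OF m_equiv] by blast
qed

end
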